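(* Let $(M,g)$, $M=\mathbb{R}\times S$, be an SOM-spacetime with Fermat metric $F$ and symmetrized pre-distance $d_s$. Then $(M,g)$ is past-distinguishing (respectively, future-distinguishing) if and only if $d_s$ is a distance, namely, $d_s(x_0,x_1)>0$ for all $x_0,x_1\in S$ with $x_0\neq x_1$.
   Context: An SOM-spacetime is a product $M=\mathbb{R}\times S$ ($S$ a connected smooth manifold of dimension at least one) with the Lorentzian metric $g=-\beta\,dt\otimes dt+dt\otimes\omega+\omega\otimes dt+g_0$, where $\beta:S\to(0,\infty)$ is a smooth function, $\omega$ a one-form on $S$, $g_0$ a symmetric $(0,2)$-tensor on $S$, and $g_0(v,v)+\frac1\beta\omega(v)^2>0$ for every nonzero $v\in TS$; it is time-oriented by the timelike Killing field $\partial_t$. Its Fermat metric is $F(v)=\frac1\beta\omega(v)+\sqrt{\frac1{\beta^2}\omega(v)^2+\frac1\beta g_0(v,v)}$. The pre-distance $d_F(x_0,x_1)\in\mathbb{R}\cup\{-\infty\}$ is the infimum of $\ell_F(c)=\int F(\dot c)\,ds$ over piecewise smooth curves $c$ from $x_0$ to $x_1$, and $d_s(x,y)=\frac12(d_F(x,y)+d_F(y,x))$. $I^{\pm}(p)$ denote the chronological future/past of $p$. $(M,g)$ is past-distinguishing (respectively future-distinguishing) if $I^-(p)=I^-(q)$ (respectively $I^+(p)=I^+(q)$) implies $p=q$. *)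

theory Defs
  imports "HOL-Analysis.Analysis"
begin

section \<open>Smooth maps between open subsets of Euclidean spaces\<close>

(* Only meaningful for open S: derivatives are taken in the ambient space. *)
primrec k_times_differentiable_on ::
    "nat \<Rightarrow> 'a::real_normed_vector set \<Rightarrow> ('a \<Rightarrow> 'b::real_normed_vector) \<Rightarrow> bool" where
  "k_times_differentiable_on 0 S f \<longleftrightarrow> continuous_on S f"
| "k_times_differentiable_on (Suc k) S f \<longleftrightarrow>
     (\<forall>x\<in>S. f differentiable (at x)) \<and>
     (\<forall>v. k_times_differentiable_on k S (\<lambda>x. frechet_derivative f (at x) v))"

definition smooth_on :: "'a::real_normed_vector set \<Rightarrow> ('a \<Rightarrow> 'b::real_normed_vector) \<Rightarrow> bool" where
  "smooth_on S f \<longleftrightarrow> (\<forall>k. k_times_differentiable_on k S f)"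


section \<open>Smooth manifolds\<close>

(* A manifold is a whole type with its topology; 'e is the model space, so that the
   dimension is DIM('e), which is always at least 1. *)
type_synonym ('s, 'e) atlas = "('s set \<times> ('s \<Rightarrow> 'e)) set"

definition is_chart :: "'s::topological_space set \<Rightarrow> ('s \<Rightarrow> 'e::euclidean_space) \<Rightarrow> bool" where
  "is_chart U \<phi> \<longleftrightarrow> open U \<and> open (\<phi> ` U) \<and> (\<exists>\<psi>. homeomorphism U (\<phi> ` U) \<phi> \<psi>)"

definition smooth_atlas :: "('s::topological_space, 'e::euclidean_space) atlas \<Rightarrow> bool" where
  "smooth_atlas A \<longleftrightarrow>
     (\<forall>(U, \<phi>)\<in>A. is_chart U \<phi>) \<and>
     (\<Union>(U, \<phi>)\<in>A. U) = UNIV \<and>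
     (\<forall>(U, \<phi>)\<in>A. \<forall>(V, \<psi>)\<in>A. smooth_on (\<phi> ` (U \<inter> V)) (\<psi> \<circ> inv_into U \<phi>))"

definition smooth_fun_on ::
    "('s::topological_space, 'e::euclidean_space) atlas \<Rightarrow> 's set \<Rightarrow> ('s \<Rightarrow> real) \<Rightarrow> bool" where
  "smooth_fun_on A W f \<longleftrightarrow> (\<forall>(U, \<phi>)\<in>A. smooth_on (\<phi> ` (U \<inter> W)) (f \<circ> inv_into U \<phi>))"

definition smooth_near ::
    "('s::topological_space, 'e::euclidean_space) atlas \<Rightarrow> 's \<Rightarrow> ('s \<Rightarrow> real) \<Rightarrow> bool" where
  "smooth_near A p f \<longleftrightarrow> (\<exists>W. open W \<and> p \<in> W \<and> smooth_fun_on A W f)"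


section \<open>Tangent vectors and tensors\<close>

(* A tangent vector at p is a derivation at p of the real functions that are smooth near p.
   The Leibniz rule forces it to depend on the germ of f at p only: if f vanishes on an open
   neighbourhood U of p, then f = f * 1_(-U), and 1_(-U) is itself smooth near p.
   Elements are normalised to 0 outside their domain so that they are determined by their
   action on germs. *)
type_synonym 's tvec = "('s \<Rightarrow> real) \<Rightarrow> real"

definition tangent_space ::
    "('s::topological_space, 'e::euclidean_space) atlas \<Rightarrow> 's \<Rightarrow> 's tvec set" where
  "tangent_space A p = {X.
     (\<forall>f. \<not> smooth_near A p f \<longrightarrow> X f = 0) \<and>
     (\<forall>f g a b. smooth_near A p f \<longrightarrow> smooth_near A p g \<longrightarrow>
        X (\<lambda>x. a * f x + b * g x) = a * X f + b * X g) \<and>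
     (\<forall>f g. smooth_near A p f \<longrightarrow> smooth_near A p g \<longrightarrow>
        X (\<lambda>x. f x * g x) = f p * X g + g p * X f)}"

definition zero_tvec :: "'s tvec" where
  "zero_tvec = (\<lambda>f. 0)"

(* The tangent vector at p with coordinates e in the chart (U, phi). *)
definition coord_tvec ::
    "('s::topological_space, 'e::euclidean_space) atlas \<Rightarrow> 's set \<Rightarrow> ('s \<Rightarrow> 'e) \<Rightarrow> 's \<Rightarrow> 'e \<Rightarrow> 's tvec"
  where
  "coord_tvec A U \<phi> p e = (\<lambda>f. if smooth_near A p f
     then frechet_derivative (f \<circ> inv_into U \<phi>) (at (\<phi> p)) e else 0)"

(* The differential at a point p with F p = q, mapping to the manifold with atlas B. *)
definition push_tvec ::
    "('s::topological_space, 'e::euclidean_space) atlas \<Rightarrow> 's \<Rightarrow> ('r \<Rightarrow> 's) \<Rightarrow> 'r tvec \<Rightarrow> 's tvec" where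
  "push_tvec B q F V = (\<lambda>f. if smooth_near B q f then V (f \<circ> F) else 0)"

definition smooth_one_form ::
    "('s::topological_space, 'e::euclidean_space) atlas \<Rightarrow> ('s \<Rightarrow> 's tvec \<Rightarrow> real) \<Rightarrow> bool" where
  "smooth_one_form A \<omega> \<longleftrightarrow>
     (\<forall>p. \<forall>X\<in>tangent_space A p. \<forall>Y\<in>tangent_space A p. \<forall>a b.
        \<omega> p (\<lambda>f. a * X f + b * Y f) = a * \<omega> p X + b * \<omega> p Y) \<and>
     (\<forall>(U, \<phi>)\<in>A. \<forall>i\<in>Basis. smooth_fun_on A U (\<lambda>p. \<omega> p (coord_tvec A U \<phi> p i)))"

definition smooth_symmetric_2_tensor ::
    "('s::topological_space, 'e::euclidean_space) atlas \<Rightarrow> ('s \<Rightarrow> 's tvec \<Rightarrow> 's tvec \<Rightarrow> real) \<Rightarrow> bool"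
  where
  "smooth_symmetric_2_tensor A h \<longleftrightarrow>
     (\<forall>p. \<forall>X\<in>tangent_space A p. \<forall>Y\<in>tangent_space A p. h p X Y = h p Y X) \<and>
     (\<forall>p. \<forall>X\<in>tangent_space A p. \<forall>Y\<in>tangent_space A p. \<forall>Z\<in>tangent_space A p. \<forall>a b.
        h p (\<lambda>f. a * X f + b * Y f) Z = a * h p X Z + b * h p Y Z) \<and>
     (\<forall>(U, \<phi>)\<in>A. \<forall>i\<in>Basis. \<forall>j\<in>Basis.
        smooth_fun_on A U (\<lambda>p. h p (coord_tvec A U \<phi> p i) (coord_tvec A U \<phi> p j)))"


section \<open>Piecewise smooth curves\<close>

(* Smoothness on an arbitrary set T of parameters: locally, c has a smooth extension in a
   chart. For T = {u..v} this is smoothness up to and including the endpoints. *)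
definition smooth_curve_on ::
    "('s::topological_space, 'e::euclidean_space) atlas \<Rightarrow> real set \<Rightarrow> (real \<Rightarrow> 's) \<Rightarrow> bool" where
  "smooth_curve_on A T c \<longleftrightarrow>
     (\<forall>t\<in>T. \<exists>(U, \<phi>)\<in>A. \<exists>J h. open J \<and> t \<in> J \<and> smooth_on J h \<and>
        (\<forall>s\<in>J \<inter> T. c s \<in> U \<and> \<phi> (c s) = h s))"

(* The derivative is taken within T, hence is one-sided at the endpoints of T = {u..v}. *)
definition velocity ::
    "('s::topological_space, 'e::euclidean_space) atlas \<Rightarrow> real set \<Rightarrow> (real \<Rightarrow> 's) \<Rightarrow> real \<Rightarrow> 's tvec"
  where
  "velocity A T c t = (\<lambda>f. if smooth_near A (c t) f
     then vector_derivative (f \<circ> c) (at t within T) else 0)"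

definition piecewise :: "(real \<Rightarrow> real \<Rightarrow> bool) \<Rightarrow> real \<Rightarrow> real \<Rightarrow> bool" where
  "piecewise P a b \<longleftrightarrow> a < b \<and>
     (\<exists>(n::nat) \<tau>. \<tau> 0 = a \<and> \<tau> n = b \<and> (\<forall>i<n. \<tau> i < \<tau> (Suc i) \<and> P (\<tau> i) (\<tau> (Suc i))))"

definition piecewise_smooth_curve ::
    "('s::topological_space, 'e::euclidean_space) atlas \<Rightarrow> real \<Rightarrow> real \<Rightarrow> (real \<Rightarrow> 's) \<Rightarrow> bool" where
  "piecewise_smooth_curve A a b c \<longleftrightarrow> piecewise (\<lambda>u v. smooth_curve_on A {u..v} c) a b"


section \<open>Causality\<close>

(* In the following, g is a Lorentzian metric of signature (-,+,...,+) on the manifold with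
   atlas A and Z is a timelike vector field giving the time orientation. *)

definition future_timelike ::
    "('m \<Rightarrow> 'm tvec \<Rightarrow> 'm tvec \<Rightarrow> real) \<Rightarrow> ('m \<Rightarrow> 'm tvec) \<Rightarrow> 'm \<Rightarrow> 'm tvec \<Rightarrow> bool" where
  "future_timelike g Z p V \<longleftrightarrow> g p V V < 0 \<and> g p V (Z p) < 0"

(* At a break point both one-sided velocities have to be future-directed timelike. *)
definition future_timelike_curve ::
    "('m::topological_space, 'e::euclidean_space) atlas \<Rightarrow> ('m \<Rightarrow> 'm tvec \<Rightarrow> 'm tvec \<Rightarrow> real) \<Rightarrow>
     ('m \<Rightarrow> 'm tvec) \<Rightarrow> real \<Rightarrow> real \<Rightarrow> (real \<Rightarrow> 'm) \<Rightarrow> bool" where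
  "future_timelike_curve A g Z a b c \<longleftrightarrow>
     piecewise (\<lambda>u v. smooth_curve_on A {u..v} c \<and>
       (\<forall>t\<in>{u..v}. future_timelike g Z (c t) (velocity A {u..v} c t))) a b"

definition chron_future ::
    "('m::topological_space, 'e::euclidean_space) atlas \<Rightarrow> ('m \<Rightarrow> 'm tvec \<Rightarrow> 'm tvec \<Rightarrow> real) \<Rightarrow>
     ('m \<Rightarrow> 'm tvec) \<Rightarrow> 'm \<Rightarrow> 'm set" where
  "chron_future A g Z p = {q. \<exists>a b c. future_timelike_curve A g Z a b c \<and> c a = p \<and> c b = q}"

definition chron_past ::
    "('m::topological_space, 'e::euclidean_space) atlas \<Rightarrow> ('m \<Rightarrow> 'm tvec \<Rightarrow> 'm tvec \<Rightarrow> real) \<Rightarrow>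
     ('m \<Rightarrow> 'm tvec) \<Rightarrow> 'm \<Rightarrow> 'm set" where
  "chron_past A g Z p = {q. \<exists>a b c. future_timelike_curve A g Z a b c \<and> c a = q \<and> c b = p}"

definition past_distinguishing ::
    "('m::topological_space, 'e::euclidean_space) atlas \<Rightarrow> ('m \<Rightarrow> 'm tvec \<Rightarrow> 'm tvec \<Rightarrow> real) \<Rightarrow>
     ('m \<Rightarrow> 'm tvec) \<Rightarrow> bool" where
  "past_distinguishing A g Z \<longleftrightarrow> (\<forall>p q. chron_past A g Z p = chron_past A g Z q \<longrightarrow> p = q)"

definition future_distinguishing ::
    "('m::topological_space, 'e::euclidean_space) atlas \<Rightarrow> ('m \<Rightarrow> 'm tvec \<Rightarrow> 'm tvec \<Rightarrow> real) \<Rightarrow>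
     ('m \<Rightarrow> 'm tvec) \<Rightarrow> bool" where
  "future_distinguishing A g Z \<longleftrightarrow> (\<forall>p q. chron_future A g Z p = chron_future A g Z q \<longrightarrow> p = q)"


section \<open>SOM-spacetimes\<close>

locale som_spacetime =
  fixes A :: "('s::{t2_space, second_countable_topology}, 'e::euclidean_space) atlas"
    and \<beta> :: "'s \<Rightarrow> real"
    and \<omega> :: "'s \<Rightarrow> 's tvec \<Rightarrow> real"
    and g0 :: "'s \<Rightarrow> 's tvec \<Rightarrow> 's tvec \<Rightarrow> real"
  assumes atlas: "smooth_atlas A"
    and connected: "connected (UNIV :: 's set)"
    and beta_smooth: "smooth_fun_on A UNIV \<beta>"
    and beta_pos: "\<And>x. 0 < \<beta> x"
    and omega: "smooth_one_form A \<omega>"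
    and g0: "smooth_symmetric_2_tensor A g0"
    and pos_def: "\<And>x v. v \<in> tangent_space A x \<Longrightarrow> v \<noteq> zero_tvec \<Longrightarrow>
                    0 < g0 x v v + 1 / \<beta> x * (\<omega> x v)\<^sup>2"

definition som_atlas :: "('s, 'e) atlas \<Rightarrow> (real \<times> 's, real \<times> 'e) atlas" where
  "som_atlas A = (\<lambda>(U, \<phi>). (UNIV \<times> U, \<lambda>(t, x). (t, \<phi> x))) ` A"

(* V fst is dt(V), the derivative of the global coordinate t along V. *)
definition som_metric ::
    "('s::topological_space, 'e::euclidean_space) atlas \<Rightarrow> ('s \<Rightarrow> real) \<Rightarrow> ('s \<Rightarrow> 's tvec \<Rightarrow> real) \<Rightarrow>
     ('s \<Rightarrow> 's tvec \<Rightarrow> 's tvec \<Rightarrow> real) \<Rightarrow>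
     real \<times> 's \<Rightarrow> (real \<times> 's) tvec \<Rightarrow> (real \<times> 's) tvec \<Rightarrow> real" where
  "som_metric A \<beta> \<omega> g0 p V W =
     (let x = snd p; v = push_tvec A x snd V; w = push_tvec A x snd W
      in - \<beta> x * V fst * W fst + V fst * \<omega> x w + \<omega> x v * W fst + g0 x v w)"

definition som_time_field ::
    "('s::topological_space, 'e::euclidean_space) atlas \<Rightarrow> real \<times> 's \<Rightarrow> (real \<times> 's) tvec" where
  "som_time_field A p = velocity (som_atlas A) UNIV (\<lambda>s. (s, snd p)) (fst p)"

definition fermat_metric ::
    "('s \<Rightarrow> real) \<Rightarrow> ('s \<Rightarrow> 's tvec \<Rightarrow> real) \<Rightarrow> ('s \<Rightarrow> 's tvec \<Rightarrow> 's tvec \<Rightarrow> real) \<Rightarrow>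
     's \<Rightarrow> 's tvec \<Rightarrow> real" where
  "fermat_metric \<beta> \<omega> g0 x v =
     1 / \<beta> x * \<omega> x v + sqrt (1 / (\<beta> x)\<^sup>2 * (\<omega> x v)\<^sup>2 + 1 / \<beta> x * g0 x v v)"

(* The integrand is unspecified at the finitely many break points of c, which does not
   affect the integral. *)
definition curve_length ::
    "('s::topological_space, 'e::euclidean_space) atlas \<Rightarrow> ('s \<Rightarrow> 's tvec \<Rightarrow> real) \<Rightarrow>
     real \<Rightarrow> real \<Rightarrow> (real \<Rightarrow> 's) \<Rightarrow> real" where
  "curve_length A F a b c = integral {a..b} (\<lambda>s. F (c s) (velocity A {a..b} c s))"

definition pre_dist ::
    "('s::topological_space, 'e::euclidean_space) atlas \<Rightarrow> ('s \<Rightarrow> 's tvec \<Rightarrow> real) \<Rightarrow> 's \<Rightarrow> 's \<Rightarrow> ereal"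
  where
  "pre_dist A F x y = Inf {ereal (curve_length A F a b c) | a b c.
     piecewise_smooth_curve A a b c \<and> c a = x \<and> c b = y}"

definition sym_pre_dist ::
    "('s::topological_space, 'e::euclidean_space) atlas \<Rightarrow> ('s \<Rightarrow> 's tvec \<Rightarrow> real) \<Rightarrow> 's \<Rightarrow> 's \<Rightarrow> ereal"
  where
  "sym_pre_dist A F x y = (pre_dist A F x y + pre_dist A F y x) / 2"

end

theory Submission
  imports Defs
begin

text \<open>
  Every curve in \<open>\<real> \<times> S\<close> is a pair \<open>(t(s), c(s))\<close>, and solving the quadratic inequality
  \<open>g(V, V) < 0\<close> for the time component shows that it is future-directed timelike exactly when
  \<open>t' > F(c')\<close> (\<^emph>\<open>future_timelike_iff\<close>). Integrating, a timelike curve from \<open>(t0, x0)\<close> to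
  \<open>(t1, x1)\<close> projects to a curve of Fermat length less than \<open>t1 - t0\<close>. Conversely, a curve in \<open>S\<close>
  that is this short can be lifted: some time function with \<open>t' > F(c')\<close> has increment exactly
  \<open>t1 - t0\<close>. Hence
  \<open>(t1, x1)\<close> lies in the chronological future of \<open>(t0, x0)\<close> iff \<open>d_F(x0, x1) < t1 - t0\<close>
  (\<^emph>\<open>chronological_chain_iff_pre_dist\<close>). The only analytic obstacle is that \<open>F(c')\<close> need not be
  smooth where \<open>c'\<close> vanishes, so \<open>t'\<close> cannot be taken to be \<open>F(c')\<close> plus a constant; a polynomial
  approximation of \<open>F(c')\<close> takes its place.

  With this description the chronological past of \<open>(t, x)\<close> is the region below the graph of
  \<open>z \<mapsto> t - d_F(z, x)\<close>, and the theorem becomes a statement about the pre-distance alone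
  (\<^emph>\<open>shifted_balls_separate_iff_pos\<close>). If \<open>d_F(x, y) + d_F(y, x) \<le> 0\<close> and both terms are finite, the
  triangle inequality makes \<open>d_F(\<cdot>, x)\<close> and \<open>d_F(\<cdot>, y)\<close> differ by a constant, so a suitable time
  shift gives the points over \<open>x\<close> and \<open>y\<close> the same past; if one term is \<open>-\<infinity>\<close>, then \<open>d_F\<close> is
  \<open>-\<infinity>\<close> throughout and every past is the whole spacetime. If on the other hand
  \<open>(s, x)\<close> and \<open>(t, y)\<close> have the same past, evaluation
  at \<open>z = x\<close> and \<open>z = y\<close> yields \<open>d_F(x, y) \<le> t - s\<close> and \<open>d_F(y, x) \<le> s - t\<close>, hence a nonpositive
  symmetrized pre-distance. The future case is the same statement for the reversed pre-distance.
  Besides the triangle inequality this uses \<open>d_F(x, x) \<le> 0\<close>, because of constant curves, and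
  \<open>d_F < +\<infinity>\<close>, because \<open>S\<close> is connected.

  Both piecewise smooth and piecewise timelike curves are handled as chains of single smooth
  segments, that is, through the transitive closure of a relation on their end points. To keep
  track of length in the same way, a curve in \<open>S\<close> is paired with a real function whose increment
  over each segment is the length of that segment.
\<close>

section \<open>Calculus of smooth maps\<close>

lemma k_times_differentiable_on_subset:
  "k_times_differentiable_on k S f \<Longrightarrow> T \<subseteq> S \<Longrightarrow> k_times_differentiable_on k T f"
  by (induction k arbitrary: f) (auto intro: continuous_on_subset)

lemma frechet_derivative_cong_open:
  assumes "open S" "x \<in> S" "\<And>y. y \<in> S \<Longrightarrow> f y = g y"
  shows "frechet_derivative f (at x) = frechet_derivative g (at x)"
proof -
  have "(f has_derivative D) (at x) \<longleftrightarrow> (g has_derivative D) (at x)" for D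
    using has_derivative_transform_within_open[of f D x UNIV S g]
      has_derivative_transform_within_open[of g D x UNIV S f] assms by auto
  then show ?thesis
    by (simp add: frechet_derivative_def)
qed

lemma k_times_differentiable_on_cong:
  assumes "open S"
  shows "(\<And>x. x \<in> S \<Longrightarrow> f x = g x) \<Longrightarrow>
    k_times_differentiable_on k S f \<Longrightarrow> k_times_differentiable_on k S g"
proof (induction k arbitrary: f g)
  case 0
  then show ?case by (simp cong: continuous_on_cong)
next
  case (Suc k)
  have "g differentiable at x" if x: "x \<in> S" for x
  proof -
    obtain D where "(f has_derivative D) (at x)"
      using Suc.prems(2) x by (auto simp: differentiable_def)
    then have "(g has_derivative D) (at x)"
      using has_derivative_transform_within_open[of f D x UNIV S g] assms Suc.prems(1) that by auto
    then show ?thesis by (auto simp: differentiable_def)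
  qed
  moreover have "k_times_differentiable_on k S (\<lambda>x. frechet_derivative g (at x) v)" for v
  proof (rule Suc.IH)
    show "k_times_differentiable_on k S (\<lambda>x. frechet_derivative f (at x) v)"
      using Suc.prems(2) by simp
    show "frechet_derivative f (at x) v = frechet_derivative g (at x) v" if "x \<in> S" for x
      using frechet_derivative_cong_open[OF assms that, of f g] Suc.prems(1) by simp
  qed
  ultimately show ?case by simp
qed

text \<open>The product rule leaves the undifferentiated factors in place, so its induction step needs the
  factors themselves at one order less than assumed.\<close>

lemma k_times_differentiable_on_Suc_imp:
  "k_times_differentiable_on (Suc k) S f \<Longrightarrow> k_times_differentiable_on k S f"
proof (induction k arbitrary: f)
  case 0
  then show ?case
    by (auto intro!: continuous_at_imp_continuous_on differentiable_imp_continuous_within)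
next
  case (Suc k)
  from Suc.prems show ?case
    by (subst k_times_differentiable_on.simps) (auto intro!: Suc.IH)
qed

lemma k_times_differentiable_on_const: "k_times_differentiable_on k S (\<lambda>x. c)"
  by (induction k arbitrary: c) auto

lemma k_times_differentiable_on_linear_compose:
  assumes "open S" "bounded_linear L"
  shows "k_times_differentiable_on k S f \<Longrightarrow> k_times_differentiable_on k S (\<lambda>x. L (f x))"
proof (induction k arbitrary: f)
  case 0
  then show ?case
    using assms(2) by (simp add: bounded_linear.continuous_on)
next
  case (Suc k)
  have D: "((\<lambda>x. L (f x)) has_derivative (\<lambda>v. L (frechet_derivative f (at x) v))) (at x)"
    if "x \<in> S" for x
    using Suc.prems that assms(2)
    by (auto simp: frechet_derivative_works intro: bounded_linear.has_derivative)
  have "k_times_differentiable_on k S (\<lambda>x. frechet_derivative (\<lambda>x. L (f x)) (at x) v)" for v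
  proof (rule k_times_differentiable_on_cong[OF assms(1)])
    show "k_times_differentiable_on k S (\<lambda>x. L (frechet_derivative f (at x) v))"
      using Suc by simp
    show "L (frechet_derivative f (at x) v) = frechet_derivative (\<lambda>x. L (f x)) (at x) v"
      if "x \<in> S" for x
      using frechet_derivative_at[OF D[OF that]] by metis
  qed
  with D show ?case by (auto simp: differentiable_def)
qed

lemma k_times_differentiable_on_add:
  assumes "open S"
  shows "k_times_differentiable_on k S f \<Longrightarrow> k_times_differentiable_on k S g \<Longrightarrow>
    k_times_differentiable_on k S (\<lambda>x. f x + g x)"
proof (induction k arbitrary: f g)
  case 0
  then show ?case by (simp add: continuous_on_add)
next
  case (Suc k)
  have D: "((\<lambda>x. f x + g x) has_derivative
      (\<lambda>v. frechet_derivative f (at x) v + frechet_derivative g (at x) v)) (at x)"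
    if "x \<in> S" for x
    using Suc.prems that by (auto simp: frechet_derivative_works intro: has_derivative_add)
  have "k_times_differentiable_on k S (\<lambda>x. frechet_derivative (\<lambda>x. f x + g x) (at x) v)" for v
  proof (rule k_times_differentiable_on_cong[OF assms(1)])
    show "k_times_differentiable_on k S
        (\<lambda>x. frechet_derivative f (at x) v + frechet_derivative g (at x) v)"
      using Suc by simp
    show "frechet_derivative f (at x) v + frechet_derivative g (at x) v =
        frechet_derivative (\<lambda>x. f x + g x) (at x) v" if "x \<in> S" for x
      using frechet_derivative_at[OF D[OF that]] by metis
  qed
  with D show ?case by (auto simp: differentiable_def)
qed

lemma k_times_differentiable_on_mult:
  fixes f g :: "'a::real_normed_vector \<Rightarrow> real"
  assumes "open S"
  shows "k_times_differentiable_on k S f \<Longrightarrow> k_times_differentiable_on k S g \<Longrightarrow>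
    k_times_differentiable_on k S (\<lambda>x. f x * g x)"
proof (induction k arbitrary: f g)
  case 0
  then show ?case by (simp add: continuous_on_mult)
next
  case (Suc k)
  have D: "((\<lambda>x. f x * g x) has_derivative
      (\<lambda>v. f x * frechet_derivative g (at x) v + frechet_derivative f (at x) v * g x)) (at x)"
    if "x \<in> S" for x
    using Suc.prems that by (auto simp: frechet_derivative_works intro: has_derivative_mult)
  have "k_times_differentiable_on k S (\<lambda>x. frechet_derivative (\<lambda>x. f x * g x) (at x) v)" for v
  proof (rule k_times_differentiable_on_cong[OF assms(1)])
    show "k_times_differentiable_on k S
        (\<lambda>x. f x * frechet_derivative g (at x) v + frechet_derivative f (at x) v * g x)"
      using Suc.prems k_times_differentiable_on_Suc_imp[OF Suc.prems(1)]
        k_times_differentiable_on_Suc_imp[OF Suc.prems(2)]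
      by (intro k_times_differentiable_on_add[OF assms] Suc.IH) auto
    show "f x * frechet_derivative g (at x) v + frechet_derivative f (at x) v * g x =
        frechet_derivative (\<lambda>x. f x * g x) (at x) v" if "x \<in> S" for x
      using frechet_derivative_at[OF D[OF that]] by metis
  qed
  with D show ?case by (auto simp: differentiable_def)
qed

text \<open>Affine maps are the only inner maps needed: translations of the parameter of a curve and the
  projection of the product spacetime to \<open>S\<close>. With \<open>l x = L x + a\<close>, the derivative of \<open>f \<circ> l\<close> in the
  direction \<open>v\<close> is \<open>g \<circ> l\<close>, where \<open>g\<close> is the derivative of \<open>f\<close> in the direction \<open>L v\<close>. This reproduces the same shape, so that the induction closes without a formula for higher derivatives.\<close>

lemma k_times_differentiable_on_affine_compose:
  assumes "open T" "bounded_linear L" "\<And>x. x \<in> T \<Longrightarrow> L x + a \<in> S"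
  shows "k_times_differentiable_on k S f \<Longrightarrow> k_times_differentiable_on k T (\<lambda>x. f (L x + a))"
proof (induction k arbitrary: f)
  case 0
  have "continuous_on T (\<lambda>x. L x + a)"
    using assms(2) by (intro continuous_on_add continuous_on_const linear_continuous_on)
  then have "continuous_on T (\<lambda>x. f (L x + a))"
    using continuous_on_compose2[of S f T "\<lambda>x. L x + a"] 0 assms(3) by auto
  then show ?case by simp
next
  case (Suc k)
  have D: "((\<lambda>x. f (L x + a)) has_derivative
      (\<lambda>v. frechet_derivative f (at (L x + a)) (L v))) (at x)" if "x \<in> T" for x
  proof (rule has_derivative_compose[where f = "\<lambda>x. L x + a" and f' = L])
    show "((\<lambda>x. L x + a) has_derivative L) (at x)"
      using assms(2) by (auto intro!: derivative_eq_intros bounded_linear_imp_has_derivative)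
    show "(f has_derivative frechet_derivative f (at (L x + a))) (at (L x + a))"
      using Suc.prems assms(3)[OF that] by (auto simp: frechet_derivative_works)
  qed
  have "k_times_differentiable_on k T (\<lambda>x. frechet_derivative (\<lambda>x. f (L x + a)) (at x) v)" for v
  proof (rule k_times_differentiable_on_cong[OF assms(1)])
    show "k_times_differentiable_on k T (\<lambda>x. frechet_derivative f (at (L x + a)) (L v))"
      using Suc.prems by (intro Suc.IH[where f = "\<lambda>y. frechet_derivative f (at y) (L v)"]) simp
    show "frechet_derivative f (at (L x + a)) (L v) = frechet_derivative (\<lambda>x. f (L x + a)) (at x) v"
      if "x \<in> T" for x
      using frechet_derivative_at[OF D[OF that]] by metis
  qed
  with D show ?case by (auto simp: differentiable_def)
qed

lemma smooth_on_subset: "smooth_on S f \<Longrightarrow> T \<subseteq> S \<Longrightarrow> smooth_on T f"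
  by (auto simp: smooth_on_def intro: k_times_differentiable_on_subset)

lemma smooth_on_cong:
  "open S \<Longrightarrow> (\<And>x. x \<in> S \<Longrightarrow> f x = g x) \<Longrightarrow> smooth_on S f \<Longrightarrow> smooth_on S g"
  unfolding smooth_on_def by (blast intro: k_times_differentiable_on_cong)

lemma smooth_on_const: "smooth_on S (\<lambda>x. c)"
  by (simp add: smooth_on_def k_times_differentiable_on_const)

lemma smooth_on_ident: "smooth_on S (\<lambda>x. x)"
proof -
  have "k_times_differentiable_on k S (\<lambda>x. x)" for k
    by (cases k) (auto simp: k_times_differentiable_on_const)
  then show ?thesis by (simp add: smooth_on_def)
qed

lemma smooth_on_linear_compose:
  "open S \<Longrightarrow> bounded_linear L \<Longrightarrow> smooth_on S f \<Longrightarrow> smooth_on S (\<lambda>x. L (f x))"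
  by (simp add: smooth_on_def k_times_differentiable_on_linear_compose)

lemma smooth_on_add:
  "open S \<Longrightarrow> smooth_on S f \<Longrightarrow> smooth_on S g \<Longrightarrow> smooth_on S (\<lambda>x. f x + g x)"
  by (simp add: smooth_on_def k_times_differentiable_on_add)

lemma smooth_on_mult:
  fixes f g :: "'a::real_normed_vector \<Rightarrow> real"
  shows "open S \<Longrightarrow> smooth_on S f \<Longrightarrow> smooth_on S g \<Longrightarrow> smooth_on S (\<lambda>x. f x * g x)"
  by (simp add: smooth_on_def k_times_differentiable_on_mult)

lemma smooth_on_affine_compose:
  "open T \<Longrightarrow> bounded_linear L \<Longrightarrow> (\<And>x. x \<in> T \<Longrightarrow> L x + a \<in> S) \<Longrightarrow> smooth_on S f \<Longrightarrow>
    smooth_on T (\<lambda>x. f (L x + a))"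
  unfolding smooth_on_def by (blast intro: k_times_differentiable_on_affine_compose)

lemma smooth_on_Pair:
  assumes "open S" "smooth_on S f" "smooth_on S g"
  shows "smooth_on S (\<lambda>x. (f x, g x))"
proof -
  have "smooth_on S (\<lambda>x. (f x, 0) + (0, g x))"
    using assms
    by (intro smooth_on_add smooth_on_linear_compose[where L = "\<lambda>y. (y, 0)"]
        smooth_on_linear_compose[where L = "\<lambda>y. (0, y)"])
      (auto intro!: bounded_linear_Pair bounded_linear_zero bounded_linear_ident)
  then show ?thesis by simp
qed

lemma smooth_on_real_polynomial_function:
  fixes p :: "real \<Rightarrow> real"
  shows "real_polynomial_function p \<Longrightarrow> smooth_on UNIV p"
proof (induction rule: real_polynomial_function.induct)
  case (linear f)
  then show ?case
    by (rule smooth_on_linear_compose[OF open_UNIV _ smooth_on_ident])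
qed (auto intro: smooth_on_const smooth_on_add smooth_on_mult)

lemma smooth_on_imp_continuous_on: "smooth_on S f \<Longrightarrow> continuous_on S f"
  unfolding smooth_on_def by (metis k_times_differentiable_on.simps(1))

lemma smooth_on_imp_has_derivative:
  assumes "smooth_on S f" "x \<in> S"
  shows "(f has_derivative frechet_derivative f (at x)) (at x)"
proof -
  have "k_times_differentiable_on (Suc 0) S f"
    using assms(1) unfolding smooth_on_def by blast
  then show ?thesis
    using assms(2) by (simp add: frechet_derivative_works)
qed

lemma smooth_on_imp_continuous_on_derivative:
  assumes "smooth_on S f"
  shows "continuous_on S (\<lambda>x. frechet_derivative f (at x) v)"
proof -
  have "k_times_differentiable_on (Suc 0) S f"
    using assms unfolding smooth_on_def by blast
  then show ?thesis by simp
qed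

section \<open>Piecewise curves as chains of segments\<close>

lemma piecewise_iff_tranclp:
  "piecewise P a b \<longleftrightarrow> tranclp (\<lambda>u v. u < v \<and> P u v) a b"
proof
  let ?R = "\<lambda>u v. u < v \<and> P u v"
  assume "piecewise P a b"
  then obtain n \<tau> where "a < b" and \<tau>: "\<tau> (0::nat) = a" "\<tau> n = b"
    "\<And>i. i < n \<Longrightarrow> ?R (\<tau> i) (\<tau> (Suc i))"
    unfolding piecewise_def by blast
  have "0 < m \<Longrightarrow> m \<le> n \<Longrightarrow> tranclp ?R (\<tau> 0) (\<tau> m)" for m
  proof (induction m)
    case (Suc m)
    then show ?case
      using \<tau>(3)[of m] by (cases "m = 0") (auto intro: tranclp.trancl_into_trancl)
  qed simp
  moreover have "0 < n" using \<open>a < b\<close> \<tau> by (cases n) auto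
  ultimately show "tranclp ?R a b" using \<tau> by blast
next
  assume "tranclp (\<lambda>u v. u < v \<and> P u v) a b"
  then show "piecewise P a b"
  proof induction
    case (base v)
    then show ?case
      unfolding piecewise_def
      by (intro conjI exI[of _ 1] exI[of _ "\<lambda>i. if i = 0 then a else v"]) auto
  next
    case (step u v)
    then obtain n \<tau> where "a < u" and \<tau>: "\<tau> (0::nat) = a" "\<tau> n = u"
      "\<And>i. i < n \<Longrightarrow> \<tau> i < \<tau> (Suc i) \<and> P (\<tau> i) (\<tau> (Suc i))"
      unfolding piecewise_def by blast
    with step show ?case
      unfolding piecewise_def
      by (intro conjI exI[of _ "Suc n"] exI[of _ "\<tau>(Suc n := v)"]) (auto simp: less_Suc_eq)
  qed
qed

definition segment_rel :: "((real \<Rightarrow> 'a) \<Rightarrow> real \<Rightarrow> real \<Rightarrow> bool) \<Rightarrow> 'a \<Rightarrow> 'a \<Rightarrow> bool" where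
  "segment_rel P x y \<longleftrightarrow> (\<exists>c u v. u < v \<and> P c u v \<and> c u = x \<and> c v = y)"

text \<open>Two segments can be glued if the property depends on nothing but the values on the interval
  and the parameter can be shifted so that the second segment starts where the first one ends.\<close>
definition glueable :: "((real \<Rightarrow> 'a) \<Rightarrow> real \<Rightarrow> real \<Rightarrow> bool) \<Rightarrow> bool" where
  "glueable P \<longleftrightarrow>
     (\<forall>c d u v. u < v \<longrightarrow> (\<forall>s\<in>{u..v}. c s = d s) \<longrightarrow> P c u v \<longrightarrow> P d u v) \<and>
     (\<forall>c u v k. P c u v \<longrightarrow> P (\<lambda>s. c (s - k)) (u + k) (v + k))"

text \<open>All intervals of a subdivision lie between its end points, so a property of the pieces may be
  replaced by another one that is implied only there.\<close>

lemma tranclp_less_mono: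
  fixes a b :: real
  assumes "tranclp (\<lambda>u v. u < v \<and> P u v) a b"
    and "\<And>u v. a \<le> u \<Longrightarrow> u < v \<Longrightarrow> v \<le> b \<Longrightarrow> P u v \<Longrightarrow> Q u v"
  shows "tranclp (\<lambda>u v. u < v \<and> Q u v) a b \<and> a < b"
  using assms
proof induction
  case (step u v)
  then have "tranclp (\<lambda>u v. u < v \<and> Q u v) a u" "a < u" by auto
  moreover have "u < v \<and> Q u v" using step.prems[of u v] step.hyps \<open>a < u\<close> by auto
  ultimately show ?case by (auto intro: tranclp.trancl_into_trancl)
qed auto

text \<open>Gluing turns a chain of segments into one curve, by translating the parameter of each
  further segment. Concatenation of curves thereby becomes transitivity of the closure.\<close>

lemma piecewise_curve_iff_tranclp:
  assumes "glueable P"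
  shows "(\<exists>a b c. piecewise (P c) a b \<and> c a = x \<and> c b = y) \<longleftrightarrow> tranclp (segment_rel P) x y"
proof
  assume "\<exists>a b c. piecewise (P c) a b \<and> c a = x \<and> c b = y"
  then obtain a b c where "tranclp (\<lambda>u v. u < v \<and> P c u v) a b" and c: "c a = x" "c b = y"
    unfolding piecewise_iff_tranclp by blast
  then have "tranclp (segment_rel P) (c a) (c b)"
  proof (induction arbitrary: y)
    case (base v)
    then show ?case by (auto simp: segment_rel_def)
  next
    case (step u v)
    then have "segment_rel P (c u) (c v)" by (auto simp: segment_rel_def)
    with step show ?case by (auto intro: tranclp.trancl_into_trancl)
  qed
  with c show "tranclp (segment_rel P) x y" by simp
next
  assume "tranclp (segment_rel P) x y"
  then show "\<exists>a b c. piecewise (P c) a b \<and> c a = x \<and> c b = y"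
  proof induction
    case (base y)
    then obtain c u v where "u < v" "P c u v" "c u = x" "c v = y"
      by (auto simp: segment_rel_def)
    then show ?case
      unfolding piecewise_iff_tranclp
      by (intro exI[of _ u] exI[of _ v] exI[of _ c]) auto
  next
    case (step y z)
    then obtain a b c where c: "tranclp (\<lambda>u v. u < v \<and> P c u v) a b" "c a = x" "c b = y"
      unfolding piecewise_iff_tranclp by blast
    from step obtain d u v where d: "u < v" "P d u v" "d u = y" "d v = z"
      by (auto simp: segment_rel_def)
    define e where "e = (\<lambda>s. if s \<le> b then c s else d (s - (b - u)))"
    have local: "\<And>c d u v. u < v \<Longrightarrow> \<forall>s\<in>{u..v}. c s = d s \<Longrightarrow> P c u v \<Longrightarrow> P d u v"
      and shift: "\<And>c u v k. P c u v \<Longrightarrow> P (\<lambda>s. c (s - k)) (u + k) (v + k)"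
      using assms unfolding glueable_def by blast+
    have "tranclp (\<lambda>u v. u < v \<and> P e u v) a b \<and> a < b"
    proof (rule tranclp_less_mono[OF c(1)])
      fix u' v' assume "a \<le> u'" "u' < v'" "v' \<le> b" "P c u' v'"
      then show "P e u' v'" by (intro local[of u' v' c e]) (auto simp: e_def)
    qed
    moreover have "P (\<lambda>s. d (s - (b - u))) (u + (b - u)) (v + (b - u))"
      using d(2) by (rule shift)
    then have "P e b (v + (b - u))"
      using d c(3) by (intro local[of b _ "\<lambda>s. d (s - (b - u))" e]) (auto simp: e_def)
    ultimately have "tranclp (\<lambda>u v. u < v \<and> P e u v) a (v + (b - u))" "a < b"
      using d(1) by (auto intro: tranclp.trancl_into_trancl)
    moreover have "e a = x" "e (v + (b - u)) = z"
      using c d \<open>a < b\<close> by (auto simp: e_def)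
    ultimately show ?case unfolding piecewise_iff_tranclp by blast
  qed
qed

section \<open>Velocity and length of curves\<close>

lemma vector_derivative_cong_on:
  assumes "t \<in> T" "\<And>s. s \<in> T \<Longrightarrow> f s = g s"
  shows "vector_derivative f (at t within T) = vector_derivative g (at t within T)"
proof -
  have "(f has_vector_derivative D) (at t within T) \<longleftrightarrow> (g has_vector_derivative D) (at t within T)"
    for D
    using has_vector_derivative_transform[of t T f g D]
      has_vector_derivative_transform[of t T g f D] assms by auto
  then show ?thesis by (simp add: vector_derivative_def)
qed

lemma vector_derivative_shift:
  fixes f :: "real \<Rightarrow> 'a::real_normed_vector"
  shows "vector_derivative (\<lambda>s. f (s - k)) (at t within {u + k..v + k}) =
    vector_derivative f (at (t - k) within {u..v})"
proof -
  have "((\<lambda>s. f (s - k)) has_vector_derivative D) (at t within {u + k..v + k}) \<longleftrightarrow>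
      (f has_vector_derivative D) (at (t - k) within {u..v})" (is "?L \<longleftrightarrow> ?R") for D
  proof
    assume ?L
    moreover have "((\<lambda>s. s + k) has_vector_derivative 1) (at (t - k) within {u..v})"
      by (auto intro!: derivative_eq_intros)
    moreover have "(\<lambda>s. s + k) ` {u..v} = {u + k..v + k}" by simp
    ultimately show ?R
      using vector_diff_chain_within[of "\<lambda>s. s + k" 1 "t - k" "{u..v}" "\<lambda>s. f (s - k)" D]
      by (simp add: o_def)
  next
    assume ?R
    moreover have "((\<lambda>s. s - k) has_vector_derivative 1) (at t within {u + k..v + k})"
      by (auto intro!: derivative_eq_intros)
    moreover have "(\<lambda>s. s - k) ` {u + k..v + k} = {u..v}"
      by simp
    ultimately show ?L
      using vector_diff_chain_within[of "\<lambda>s. s - k" 1 t "{u + k..v + k}" f D]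
      by (simp add: o_def)
  qed
  then show ?thesis by (simp add: vector_derivative_def)
qed

lemma velocity_cong:
  assumes "t \<in> T" "\<And>s. s \<in> T \<Longrightarrow> c s = d s"
  shows "velocity A T c t = velocity A T d t"
proof -
  have "vector_derivative (f \<circ> c) (at t within T) = vector_derivative (f \<circ> d) (at t within T)" for f :: "_ \<Rightarrow> real"
    using assms by (intro vector_derivative_cong_on) auto
  with assms show ?thesis by (simp add: velocity_def cong: if_cong)
qed

lemma velocity_shift:
  "velocity A {u + k..v + k} (\<lambda>s. c (s - k)) t = velocity A {u..v} c (t - k)"
  using vector_derivative_shift[of "f \<circ> c" k for f :: "_ \<Rightarrow> real"] by (simp add: velocity_def o_def cong: if_cong)

text \<open>The velocity of a segment and that of a longer curve containing it differ at most at the end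
  points of the segment, hence have the same integral.\<close>

lemma velocity_interior:
  assumes "t \<in> interior T" "t \<in> interior T'"
  shows "velocity A T c t = velocity A T' c t"
  unfolding velocity_def at_within_interior[OF assms(1)] at_within_interior[OF assms(2)] ..

lemma smooth_curve_onE:
  assumes "smooth_curve_on A T c" "t \<in> T"
  obtains U \<phi> J h where "(U, \<phi>) \<in> A" "open J" "t \<in> J" "smooth_on J h"
    "\<And>s. s \<in> J \<inter> T \<Longrightarrow> c s \<in> U \<and> \<phi> (c s) = h s"
proof -
  obtain U \<phi> J h where "(U, \<phi>) \<in> A" "open J" "t \<in> J" "smooth_on J h"
    and "\<forall>s\<in>J \<inter> T. c s \<in> U \<and> \<phi> (c s) = h s"
    using assms unfolding smooth_curve_on_def by blast
  then show ?thesis using that[of U \<phi> J h] by blast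
qed

lemma smooth_curve_on_cong:
  assumes "smooth_curve_on A T c" "T' \<subseteq> T" "\<And>s. s \<in> T' \<Longrightarrow> c s = d s"
  shows "smooth_curve_on A T' d"
  unfolding smooth_curve_on_def
proof
  fix t assume "t \<in> T'"
  then obtain U \<phi> J h where *: "(U, \<phi>) \<in> A" "open J" "t \<in> J" "smooth_on J h"
    "\<forall>s\<in>J \<inter> T. c s \<in> U \<and> \<phi> (c s) = h s"
    using assms(1,2) unfolding smooth_curve_on_def by blast
  have "d s \<in> U \<and> \<phi> (d s) = h s" if "s \<in> J \<inter> T'" for s
    using * assms(2) assms(3)[of s] that by (metis IntD1 IntD2 IntI subsetD)
  with * show "\<exists>(U, \<phi>)\<in>A. \<exists>J h. open J \<and> t \<in> J \<and> smooth_on J h \<and>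
      (\<forall>s\<in>J \<inter> T'. d s \<in> U \<and> \<phi> (d s) = h s)"
    by blast
qed

lemma smooth_curve_on_shift:
  assumes "smooth_curve_on A {u..v} c"
  shows "smooth_curve_on A {u + k..v + k} (\<lambda>s. c (s - k))"
  unfolding smooth_curve_on_def
proof
  fix t assume "t \<in> {u + k..v + k}"
  then have "t - k \<in> {u..v}" by auto
  then obtain U \<phi> J h where "(U, \<phi>) \<in> A" and J: "open J" "t - k \<in> J" "smooth_on J h"
    "\<forall>s\<in>J \<inter> {u..v}. c s \<in> U \<and> \<phi> (c s) = h s"
    using assms unfolding smooth_curve_on_def by blast
  have "open ((\<lambda>s. s - k) -` J)"
    using J(1) by (intro open_vimage continuous_intros)
  moreover have "smooth_on ((\<lambda>s. s - k) -` J) (\<lambda>s. h (s + - k))"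
    by (rule smooth_on_affine_compose[where L = "\<lambda>s. s", OF calculation bounded_linear_ident _ J(3)]) simp
  ultimately show "\<exists>(U, \<phi>)\<in>A. \<exists>J h. open J \<and> t \<in> J \<and> smooth_on J h \<and>
      (\<forall>s\<in>J \<inter> {u + k..v + k}. c (s - k) \<in> U \<and> \<phi> (c (s - k)) = h s)"
    using \<open>(U, \<phi>) \<in> A\<close> J
    by (intro bexI[of _ "(U, \<phi>)"] case_prodI exI[of _ "(\<lambda>s. s - k) -` J"]
        exI[of _ "\<lambda>s. h (s + - k)"]) auto
qed

lemma curve_length_cong:
  assumes "\<And>s. s \<in> {u..v} \<Longrightarrow> c s = d s"
  shows "curve_length A F u v c = curve_length A F u v d"
  unfolding curve_length_def
proof (rule integral_cong)
  fix s assume s: "s \<in> {u..v}"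
  show "F (c s) (velocity A {u..v} c s) = F (d s) (velocity A {u..v} d s)"
    using velocity_cong[of s "{u..v}" c d A] assms s by simp
qed

lemma curve_length_shift:
  "curve_length A F (u + k) (v + k) (\<lambda>s. c (s - k)) = curve_length A F u v c"
  unfolding curve_length_def velocity_shift
  using integral_shift_real_ivl[of u "- k" v "\<lambda>s. F (c s) (velocity A {u..v} c s)"] by simp

section \<open>Tangent vectors in charts\<close>

lemma chart_facts:
  assumes "smooth_atlas A" "(U, \<phi>) \<in> A"
  shows "open U" "inj_on \<phi> U" "continuous_on U \<phi>" "continuous_on (\<phi> ` U) (inv_into U \<phi>)"
    "\<And>W. open W \<Longrightarrow> open (\<phi> ` (U \<inter> W))"
proof -
  have "is_chart U \<phi>" using assms unfolding smooth_atlas_def by blast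
  then obtain \<psi> where op: "open U" "open (\<phi> ` U)" and hom: "homeomorphism U (\<phi> ` U) \<phi> \<psi>"
    unfolding is_chart_def by blast
  show "open U" by fact
  show inj: "inj_on \<phi> U"
    using hom by (metis homeomorphism_apply1 inj_onI)
  show "continuous_on U \<phi>"
    using hom by (simp add: homeomorphism_def)
  have inv: "inv_into U \<phi> y = \<psi> y" if "y \<in> \<phi> ` U" for y
    using hom inj that by (auto simp: homeomorphism_def)
  then show cont: "continuous_on (\<phi> ` U) (inv_into U \<phi>)"
    using hom by (simp add: homeomorphism_def cong: continuous_on_cong)
  show "open (\<phi> ` (U \<inter> W))" if "open W" for W
  proof -
    have "\<phi> ` (U \<inter> W) = \<phi> ` U \<inter> inv_into U \<phi> -` W"
      using inj by auto
    then show ?thesis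
      using continuous_open_preimage[OF cont op(2) that] by (simp add: vimage_def Int_def)
  qed
qed

lemma chart_inv [simp]:
  assumes "smooth_atlas A" "(U, \<phi>) \<in> A" "p \<in> U"
  shows "inv_into U \<phi> (\<phi> p) = p"
  using chart_facts(2)[OF assms(1,2)] assms(3) by simp

lemma chart_at:
  assumes "smooth_atlas A"
  obtains U \<phi> where "(U, \<phi>) \<in> A" "p \<in> U"
proof -
  have "p \<in> (\<Union>(U, \<phi>)\<in>A. U)" using assms unfolding smooth_atlas_def by simp
  then show ?thesis using that by blast
qed

lemma smooth_fun_on_chart:
  "smooth_fun_on A W f \<Longrightarrow> (U, \<phi>) \<in> A \<Longrightarrow> smooth_on (\<phi> ` (U \<inter> W)) (f \<circ> inv_into U \<phi>)"
  unfolding smooth_fun_on_def by blast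

lemma smooth_near_two:
  assumes "smooth_near A p f" "smooth_near A p g"
  obtains W where "open W" "p \<in> W" "smooth_fun_on A W f" "smooth_fun_on A W g"
proof -
  obtain V W where "open V" "p \<in> V" "smooth_fun_on A V f" and "open W" "p \<in> W" "smooth_fun_on A W g"
    using assms unfolding smooth_near_def by blast
  moreover have "smooth_fun_on A (V \<inter> W) h" if "smooth_fun_on A V h \<or> smooth_fun_on A W h" for h
    using that unfolding smooth_fun_on_def by (fastforce intro: smooth_on_subset)
  ultimately show ?thesis using that[of "V \<inter> W"] by blast
qed

lemma smooth_near_lincomb:
  assumes "smooth_atlas A" "smooth_near A p f" "smooth_near A p g"
  shows "smooth_near A p (\<lambda>x. a * f x + b * g x)"
proof -
  obtain W where W: "open W" "p \<in> W" "smooth_fun_on A W f" "smooth_fun_on A W g"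
    using smooth_near_two[OF assms(2,3)] .
  have "smooth_fun_on A W (\<lambda>x. a * f x + b * g x)"
    unfolding smooth_fun_on_def
  proof (clarify)
    fix U \<phi> assume U: "(U, \<phi>) \<in> A"
    have "smooth_on (\<phi> ` (U \<inter> W))
        (\<lambda>y. a * f (inv_into U \<phi> y) + b * g (inv_into U \<phi> y))"
      using chart_facts(5)[OF assms(1) U W(1)] smooth_fun_on_chart[OF _ U, unfolded o_def] W
      by (intro smooth_on_add smooth_on_mult smooth_on_const) auto
    then show "smooth_on (\<phi> ` (U \<inter> W)) ((\<lambda>x. a * f x + b * g x) \<circ> inv_into U \<phi>)"
      by (simp add: o_def)
  qed
  with W show ?thesis unfolding smooth_near_def by blast
qed

lemma smooth_near_mult:
  assumes "smooth_atlas A" "smooth_near A p f" "smooth_near A p g"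
  shows "smooth_near A p (\<lambda>x. f x * g x)"
proof -
  obtain W where W: "open W" "p \<in> W" "smooth_fun_on A W f" "smooth_fun_on A W g"
    using smooth_near_two[OF assms(2,3)] .
  have "smooth_fun_on A W (\<lambda>x. f x * g x)"
    unfolding smooth_fun_on_def
  proof (clarify)
    fix U \<phi> assume U: "(U, \<phi>) \<in> A"
    have "smooth_on (\<phi> ` (U \<inter> W)) (\<lambda>y. f (inv_into U \<phi> y) * g (inv_into U \<phi> y))"
      using chart_facts(5)[OF assms(1) U W(1)] smooth_fun_on_chart[OF _ U, unfolded o_def] W
      by (intro smooth_on_mult) auto
    then show "smooth_on (\<phi> ` (U \<inter> W)) ((\<lambda>x. f x * g x) \<circ> inv_into U \<phi>)"
      by (simp add: o_def)
  qed
  with W show ?thesis unfolding smooth_near_def by blast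
qed

lemma smooth_near_has_derivative:
  assumes "(U, \<phi>) \<in> A" "p \<in> U" "smooth_near A p f"
  shows "((f \<circ> inv_into U \<phi>) has_derivative frechet_derivative (f \<circ> inv_into U \<phi>) (at (\<phi> p)))
    (at (\<phi> p))"
proof -
  obtain W where W: "open W" "p \<in> W" "smooth_fun_on A W f"
    using assms(3) unfolding smooth_near_def by blast
  then show ?thesis
    using smooth_on_imp_has_derivative[OF smooth_fun_on_chart[OF W(3) assms(1)], of "\<phi> p"] assms(2)
    by auto
qed

lemma coord_tvec_apply:
  assumes "smooth_near A p f" "((f \<circ> inv_into U \<phi>) has_derivative D) (at (\<phi> p))"
  shows "coord_tvec A U \<phi> p e f = D e"
  using assms frechet_derivative_at[OF assms(2)] by (simp add: coord_tvec_def)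

lemma coord_tvec_in_tangent_space:
  assumes A: "smooth_atlas A" and U: "(U, \<phi>) \<in> A" "p \<in> U"
  shows "coord_tvec A U \<phi> p e \<in> tangent_space A p"
  unfolding tangent_space_def
proof (intro CollectI conjI allI impI)
  fix f g :: "'a \<Rightarrow> real" and a b
  assume f: "smooth_near A p f" and g: "smooth_near A p g"
  note Df = smooth_near_has_derivative[OF U f] and Dg = smooth_near_has_derivative[OF U g]
  have inv: "inv_into U \<phi> (\<phi> p) = p" using assms by simp
  have "(((\<lambda>x. a * f x + b * g x) \<circ> inv_into U \<phi>) has_derivative
      (\<lambda>e. a * frechet_derivative (f \<circ> inv_into U \<phi>) (at (\<phi> p)) e +
        b * frechet_derivative (g \<circ> inv_into U \<phi>) (at (\<phi> p)) e)) (at (\<phi> p))"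
    using Df Dg unfolding o_def by (intro has_derivative_add has_derivative_mult_right) auto
  from coord_tvec_apply[OF smooth_near_lincomb[OF A f g] this]
  show "coord_tvec A U \<phi> p e (\<lambda>x. a * f x + b * g x) =
      a * coord_tvec A U \<phi> p e f + b * coord_tvec A U \<phi> p e g"
    using coord_tvec_apply[OF f Df] coord_tvec_apply[OF g Dg] by simp
  have "(((\<lambda>x. f x * g x) \<circ> inv_into U \<phi>) has_derivative
      (\<lambda>e. f p * frechet_derivative (g \<circ> inv_into U \<phi>) (at (\<phi> p)) e +
        frechet_derivative (f \<circ> inv_into U \<phi>) (at (\<phi> p)) e * g p)) (at (\<phi> p))"
    using has_derivative_mult[OF Df Dg] inv by (simp add: o_def)
  from coord_tvec_apply[OF smooth_near_mult[OF A f g] this]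
  show "coord_tvec A U \<phi> p e (\<lambda>x. f x * g x) =
      f p * coord_tvec A U \<phi> p e g + g p * coord_tvec A U \<phi> p e f"
    using coord_tvec_apply[OF f Df] coord_tvec_apply[OF g Dg] by simp
qed (simp add: coord_tvec_def)

lemma coord_tvec_lincomb:
  assumes U: "(U, \<phi>) \<in> A" "p \<in> U"
  shows "coord_tvec A U \<phi> p (a *\<^sub>R e + b *\<^sub>R e') =
    (\<lambda>f. a * coord_tvec A U \<phi> p e f + b * coord_tvec A U \<phi> p e' f)"
proof
  fix f
  show "coord_tvec A U \<phi> p (a *\<^sub>R e + b *\<^sub>R e') f =
      a * coord_tvec A U \<phi> p e f + b * coord_tvec A U \<phi> p e' f"
  proof (cases "smooth_near A p f")
    case True
    note D = smooth_near_has_derivative[OF U True]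
    interpret linear "frechet_derivative (f \<circ> inv_into U \<phi>) (at (\<phi> p))"
      using D by (rule has_derivative_linear)
    show ?thesis using coord_tvec_apply[OF True D] by (simp add: add scale)
  qed (simp add: coord_tvec_def)
qed

text \<open>By the chain rule applied to \<open>(f \<circ> inv \<phi>) \<circ> h\<close>, where \<open>h\<close> is a local smooth extension of
  \<open>\<phi> \<circ> c\<close>. This carries regularity of \<open>h\<close> over to velocities, also at the end points of the interval.\<close>

lemma velocity_eq_coord_tvec:
  fixes c :: "real \<Rightarrow> 's::topological_space" and h :: "real \<Rightarrow> 'e::euclidean_space"
  assumes A: "smooth_atlas A" and U: "(U, \<phi>) \<in> A" and J: "open J" "t \<in> J" "smooth_on J h"
    and c: "\<And>s. s \<in> J \<inter> {u..v} \<Longrightarrow> c s \<in> U \<and> \<phi> (c s) = h s"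
    and t: "t \<in> {u..v}" "u < v"
  shows "velocity A {u..v} c t = coord_tvec A U \<phi> (c t) (frechet_derivative h (at t) 1)"
proof -
  have ct: "c t \<in> U" "\<phi> (c t) = h t" using c J t by auto
  let ?e = "frechet_derivative h (at t) 1"
  have Dh: "(h has_vector_derivative ?e) (at t)"
  proof -
    note D = smooth_on_imp_has_derivative[OF J(3,2)]
    interpret linear "frechet_derivative h (at t)"
      using D by (rule has_derivative_linear)
    have "frechet_derivative h (at t) x = x *\<^sub>R ?e" for x :: real
      using scale[of x 1] unfolding real_scaleR_def mult_1_right .
    then have "frechet_derivative h (at t) = (\<lambda>x. x *\<^sub>R ?e)" ..
    then show ?thesis
      unfolding has_vector_derivative_def by (rule has_derivative_eq_rhs[OF D])
  qed
  have deriv: "((f \<circ> c) has_vector_derivative coord_tvec A U \<phi> (c t) ?e f) (at t within {u..v})"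
    if f: "smooth_near A (c t) f" for f
  proof -
    note D = smooth_near_has_derivative[OF U ct(1) f]
    have "(((f \<circ> inv_into U \<phi>) \<circ> h) has_vector_derivative coord_tvec A U \<phi> (c t) ?e f) (at t)"
      using vector_derivative_diff_chain_within[of h ?e t UNIV "f \<circ> inv_into U \<phi>"
          "frechet_derivative (f \<circ> inv_into U \<phi>) (at (\<phi> (c t)))"] D Dh ct(2) f
      by (auto simp: coord_tvec_def intro: has_derivative_at_withinI)
    then have *: "((\<lambda>s. f (inv_into U \<phi> (h s))) has_vector_derivative coord_tvec A U \<phi> (c t) ?e f)
        (at t within J \<inter> {u..v})"
      by (simp add: o_def has_vector_derivative_at_within)
    have "((f \<circ> c) has_vector_derivative coord_tvec A U \<phi> (c t) ?e f) (at t within J \<inter> {u..v})"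
    proof (rule has_vector_derivative_transform[OF _ _ *])
      show "t \<in> J \<inter> {u..v}" using J t by simp
      fix s assume "s \<in> J \<inter> {u..v}"
      then have "c s \<in> U" "h s = \<phi> (c s)" using c by auto
      then show "(f \<circ> c) s = f (inv_into U \<phi> (h s))" using A U by simp
    qed
    moreover have "at t within J \<inter> {u..v} = at t within {u..v}"
      using J by (intro at_within_nhd[of t J]) auto
    ultimately show ?thesis by simp
  qed
  show "velocity A {u..v} c t = coord_tvec A U \<phi> (c t) ?e"
  proof
    fix f
    show "velocity A {u..v} c t f = coord_tvec A U \<phi> (c t) ?e f"
    proof (cases "smooth_near A (c t) f")
      case True
      then show ?thesis
        using vector_derivative_within_cbox[of u v t "f \<circ> c", OF _ _ deriv[unfolded box_real(2)[symmetric]]] t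
        by (simp add: velocity_def)
    qed (simp add: velocity_def coord_tvec_def)
  qed
qed

lemma velocity_in_tangent_space:
  assumes "smooth_atlas A" "smooth_curve_on A {u..v} c" "t \<in> {u..v}" "u < v"
  shows "velocity A {u..v} c t \<in> tangent_space A (c t)"
proof -
  obtain U \<phi> J h where *: "(U, \<phi>) \<in> A" "open J" "t \<in> J" "smooth_on J h"
    "\<And>s. s \<in> J \<inter> {u..v} \<Longrightarrow> c s \<in> U \<and> \<phi> (c s) = h s"
    using smooth_curve_onE[OF assms(2,3)] by metis
  then have "c t \<in> U" using assms(3) by auto
  then show ?thesis
    using velocity_eq_coord_tvec[OF assms(1) * assms(3,4)]
      coord_tvec_in_tangent_space[OF assms(1) *(1)] by simp
qed

lemma velocity_constant:
  assumes "at t within T \<noteq> bot"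
  shows "velocity A T (\<lambda>_. x) t = zero_tvec"
proof -
  have "vector_derivative (\<lambda>_. y) (at t within T) = 0" for y :: real
    using assms by (rule vector_derivative_within) simp
  then show ?thesis by (simp add: velocity_def zero_tvec_def o_def cong: if_cong)
qed

lemma zero_tvec_in_tangent_space: "zero_tvec \<in> tangent_space A p"
  by (simp add: zero_tvec_def tangent_space_def)

section \<open>The product spacetime\<close>

lemma som_chart_inv:
  assumes "inj_on \<phi> U" "y \<in> \<phi> ` U"
  shows "inv_into (UNIV \<times> U) (\<lambda>(t, x). (t, \<phi> x)) (t, y) = (t, inv_into U \<phi> y)"
proof (rule inv_into_f_eq)
  show "inj_on (\<lambda>(t, x). (t, \<phi> x)) (UNIV \<times> U)"
    using assms(1) by (auto simp: inj_on_def)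
qed (use assms in \<open>auto simp: inv_into_into f_inv_into_f\<close>)

text \<open>It suffices to test a function on the product in the coordinates \<open>(t, \<phi> x)\<close>. Applied to \<open>fst\<close>
  and to functions lifted from \<open>S\<close>, this identifies \<open>dt\<close> and the push-forward to \<open>S\<close> of a
  velocity with the velocities of the components of the curve.\<close>

lemma smooth_fun_on_som_atlas:
  assumes A: "smooth_atlas A" and W: "open W"
    and *: "\<And>U \<phi>. (U, \<phi>) \<in> A \<Longrightarrow>
      smooth_on (UNIV \<times> \<phi> ` (U \<inter> W)) (\<lambda>y. f (fst y, inv_into U \<phi> (snd y)))"
  shows "smooth_fun_on (som_atlas A) (UNIV \<times> W) f"
  unfolding smooth_fun_on_def som_atlas_def
proof (clarsimp)
  fix U \<phi> assume U: "(U, \<phi>) \<in> A"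
  let ?\<Phi> = "\<lambda>(t :: real, x). (t, \<phi> x)"
  have img: "?\<Phi> ` (UNIV \<times> U \<inter> UNIV \<times> W) = UNIV \<times> \<phi> ` (U \<inter> W)"
    by force
  have "open (UNIV \<times> \<phi> ` (U \<inter> W) :: (real \<times> _) set)"
    using chart_facts(5)[OF A U W] by (intro open_Times) auto
  then show "smooth_on (?\<Phi> ` (UNIV \<times> U \<inter> UNIV \<times> W)) (f \<circ> inv_into (UNIV \<times> U) ?\<Phi>)"
    unfolding img
  proof (rule smooth_on_cong[OF _ _ *[OF U]])
    fix y :: "real \<times> _" assume "y \<in> UNIV \<times> \<phi> ` (U \<inter> W)"
    then show "f (fst y, inv_into U \<phi> (snd y)) = (f \<circ> inv_into (UNIV \<times> U) ?\<Phi>) y"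
      using som_chart_inv[OF chart_facts(2)[OF A U], of "snd y" "fst y"] by auto
  qed
qed

lemma smooth_near_som_fst:
  assumes "smooth_atlas A"
  shows "smooth_near (som_atlas A) p fst"
proof -
  have "smooth_fun_on (som_atlas A) (UNIV \<times> UNIV) fst"
  proof (rule smooth_fun_on_som_atlas[OF assms open_UNIV])
    fix U \<phi> assume U: "(U, \<phi>) \<in> A"
    have "open (UNIV \<times> \<phi> ` (U \<inter> UNIV) :: (real \<times> _) set)"
      using chart_facts(5)[OF assms U open_UNIV] by (intro open_Times) auto
    then show "smooth_on (UNIV \<times> \<phi> ` (U \<inter> UNIV))
        (\<lambda>y :: real \<times> _. fst (fst y, inv_into U \<phi> (snd y)))"
      using smooth_on_linear_compose[OF _ bounded_linear_fst smooth_on_ident] by simp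
  qed
  then show ?thesis unfolding smooth_near_def by (intro exI[of _ UNIV]) simp
qed

lemma smooth_near_som_snd:
  assumes "smooth_atlas A" "smooth_near A (snd p) f"
  shows "smooth_near (som_atlas A) p (f \<circ> snd)"
proof -
  obtain W where W: "open W" "snd p \<in> W" "smooth_fun_on A W f"
    using assms(2) unfolding smooth_near_def by blast
  have "smooth_fun_on (som_atlas A) (UNIV \<times> W) (f \<circ> snd)"
  proof (rule smooth_fun_on_som_atlas[OF assms(1) W(1)])
    fix U \<phi> assume U: "(U, \<phi>) \<in> A"
    have op: "open (UNIV \<times> \<phi> ` (U \<inter> W) :: (real \<times> _) set)"
      using chart_facts(5)[OF assms(1) U W(1)] by (intro open_Times) auto
    have "smooth_on (UNIV \<times> \<phi> ` (U \<inter> W)) (\<lambda>y :: real \<times> _. (f \<circ> inv_into U \<phi>) (snd y + 0))"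
      by (rule smooth_on_affine_compose[OF op bounded_linear_snd _ smooth_fun_on_chart[OF W(3) U]])
        auto
    then show "smooth_on (UNIV \<times> \<phi> ` (U \<inter> W))
        (\<lambda>y :: real \<times> _. (f \<circ> snd) (fst y, inv_into U \<phi> (snd y)))"
      by simp
  qed
  with W show ?thesis
    unfolding smooth_near_def
    by (intro exI[of _ "UNIV \<times> W"]) (auto simp: open_Times mem_Times_iff)
qed

lemma velocity_fst:
  "smooth_atlas A \<Longrightarrow>
    velocity (som_atlas A) T c t fst = vector_derivative (fst \<circ> c) (at t within T)"
  by (simp add: velocity_def smooth_near_som_fst)

lemma push_velocity_snd:
  "smooth_atlas A \<Longrightarrow>
    push_tvec A (snd (c t)) snd (velocity (som_atlas A) T c t) = velocity A T (snd \<circ> c) t"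
  by (auto simp: push_tvec_def velocity_def smooth_near_som_snd o_assoc)

lemma smooth_curve_on_som_atlas:
  assumes "smooth_curve_on A T c" "smooth_on UNIV \<tau>"
  shows "smooth_curve_on (som_atlas A) T (\<lambda>s. (\<tau> s, c s))"
  unfolding smooth_curve_on_def
proof
  fix t assume "t \<in> T"
  then obtain U \<phi> J h where *: "(U, \<phi>) \<in> A" "open J" "t \<in> J" "smooth_on J h"
    "\<forall>s\<in>J \<inter> T. c s \<in> U \<and> \<phi> (c s) = h s"
    using assms(1) unfolding smooth_curve_on_def by blast
  then have "smooth_on J (\<lambda>s. (\<tau> s, h s))"
    using assms(2) by (intro smooth_on_Pair) (auto intro: smooth_on_subset)
  moreover have "(UNIV \<times> U, \<lambda>(t, x). (t, \<phi> x)) \<in> som_atlas A"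
    using *(1) by (force simp: som_atlas_def)
  ultimately show "\<exists>(V, \<psi>)\<in>som_atlas A. \<exists>J h. open J \<and> t \<in> J \<and> smooth_on J h \<and>
      (\<forall>s\<in>J \<inter> T. (\<tau> s, c s) \<in> V \<and> \<psi> (\<tau> s, c s) = h s)"
    using *(2,3,5)
    by (intro bexI[of _ "(UNIV \<times> U, \<lambda>(t, x). (t, \<phi> x))"] case_prodI exI[of _ J]
        exI[of _ "\<lambda>s. (\<tau> s, h s)"]) auto
qed

lemma smooth_curve_on_som_atlasD:
  assumes "smooth_curve_on (som_atlas A) T c"
  shows "smooth_curve_on A T (snd \<circ> c)"
    and "t \<in> T \<Longrightarrow> (fst \<circ> c) differentiable (at t within T)"
proof -
  have *: "\<exists>U \<phi> J h. (U, \<phi>) \<in> A \<and> open J \<and> t \<in> J \<and> smooth_on J h \<and>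
      (\<forall>s\<in>J \<inter> T. snd (c s) \<in> U \<and> fst (h s) = fst (c s) \<and> \<phi> (snd (c s)) = snd (h s))"
    if t: "t \<in> T" for t
  proof -
    obtain V \<psi> J h where "(V, \<psi>) \<in> som_atlas A" and J: "open J" "t \<in> J" "smooth_on J h"
      and c: "\<And>s. s \<in> J \<inter> T \<Longrightarrow> c s \<in> V \<and> \<psi> (c s) = h s"
      using smooth_curve_onE[OF assms t] by metis
    then obtain U \<phi> where U: "(U, \<phi>) \<in> A" and V: "V = UNIV \<times> U" "\<psi> = (\<lambda>(t, x). (t, \<phi> x))"
      by (auto simp: som_atlas_def)
    have "snd (c s) \<in> U \<and> fst (h s) = fst (c s) \<and> \<phi> (snd (c s)) = snd (h s)"
      if "s \<in> J \<inter> T" for s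
    proof -
      have "c s \<in> UNIV \<times> U" "(case c s of (t, x) \<Rightarrow> (t, \<phi> x)) = h s"
        using c that V by auto
      then show ?thesis by (cases "c s") (auto simp flip: \<open>_ = h s\<close>)
    qed
    with U J show ?thesis by blast
  qed
  show "smooth_curve_on A T (snd \<circ> c)"
    unfolding smooth_curve_on_def
  proof
    fix t assume "t \<in> T"
    from *[OF this] obtain U \<phi> J h where "(U, \<phi>) \<in> A" and J: "open J" "t \<in> J" "smooth_on J h"
      and h: "\<forall>s\<in>J \<inter> T. snd (c s) \<in> U \<and> fst (h s) = fst (c s) \<and> \<phi> (snd (c s)) = snd (h s)"
      by blast
    moreover have "smooth_on J (\<lambda>s. snd (h s))"
      using smooth_on_linear_compose[OF J(1) bounded_linear_snd J(3)] .
    ultimately show "\<exists>(U, \<phi>)\<in>A. \<exists>J h. open J \<and> t \<in> J \<and> smooth_on J h \<and>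
        (\<forall>s\<in>J \<inter> T. (snd \<circ> c) s \<in> U \<and> \<phi> ((snd \<circ> c) s) = h s)"
      by (intro bexI[of _ "(U, \<phi>)"] case_prodI exI[of _ J] exI[of _ "\<lambda>s. snd (h s)"]) auto
  qed
  show "(fst \<circ> c) differentiable (at t within T)" if t: "t \<in> T"
  proof -
    from *[OF t] obtain U \<phi> J h where "(U, \<phi>) \<in> A" and J: "open J" "t \<in> J" "smooth_on J h"
      and h: "\<forall>s\<in>J \<inter> T. snd (c s) \<in> U \<and> fst (h s) = fst (c s) \<and> \<phi> (snd (c s)) = snd (h s)"
      by blast
    let ?D = "\<lambda>x. fst (frechet_derivative h (at t) x)"
    have D: "((\<lambda>s. fst (h s)) has_derivative ?D) (at t within T)"
      by (rule has_derivative_at_withinI[OF has_derivative_fst[OF smooth_on_imp_has_derivative[OF J(3,2)]]])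
    obtain e where "0 < e" "ball t e \<subseteq> J"
      using J by (meson openE)
    have "((fst \<circ> c) has_derivative ?D) (at t within T)"
    proof (rule has_derivative_transform_within[OF D \<open>0 < e\<close> t])
      fix s assume "s \<in> T" "dist s t < e"
      then have "s \<in> J \<inter> T" using \<open>ball t e \<subseteq> J\<close> by (auto simp: dist_commute)
      with h show "fst (h s) = (fst \<circ> c) s" by simp
    qed
    then show ?thesis by (auto simp: differentiable_def)
  qed
qed

section \<open>The Fermat metric and timelike vectors\<close>

lemma linear_if_lincomb:
  fixes T :: "'a::real_vector \<Rightarrow> real"
  assumes "\<And>a b x y. T (a *\<^sub>R x + b *\<^sub>R y) = a * T x + b * T y"
  shows "linear T"
  using assms[of 1 _ 1] assms[of _ _ 0 0] by (intro linearI) auto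

lemma linear_eq_sum_Basis:
  fixes T :: "'a::euclidean_space \<Rightarrow> real"
  assumes "linear T"
  shows "T e = (\<Sum>i\<in>Basis. (e \<bullet> i) * T i)"
proof -
  have "T e = T (\<Sum>i\<in>Basis. (e \<bullet> i) *\<^sub>R i)" by (simp add: euclidean_representation)
  also have "\<dots> = (\<Sum>i\<in>Basis. (e \<bullet> i) * T i)"
    using assms by (simp add: linear_sum linear_scale)
  finally show ?thesis .
qed

context som_spacetime
begin

abbreviation "F \<equiv> fermat_metric \<beta> \<omega> g0"

lemma omega_lincomb:
  "X \<in> tangent_space A p \<Longrightarrow> Y \<in> tangent_space A p \<Longrightarrow>
    \<omega> p (\<lambda>f. a * X f + b * Y f) = a * \<omega> p X + b * \<omega> p Y"
  using omega unfolding smooth_one_form_def by blast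

lemma g0_sym: "X \<in> tangent_space A p \<Longrightarrow> Y \<in> tangent_space A p \<Longrightarrow> g0 p X Y = g0 p Y X"
  using g0 unfolding smooth_symmetric_2_tensor_def by blast

lemma g0_lincomb:
  "X \<in> tangent_space A p \<Longrightarrow> Y \<in> tangent_space A p \<Longrightarrow> Z \<in> tangent_space A p \<Longrightarrow>
    g0 p (\<lambda>f. a * X f + b * Y f) Z = a * g0 p X Z + b * g0 p Y Z"
  using g0 unfolding smooth_symmetric_2_tensor_def by blast

lemma omega_zero: "\<omega> p zero_tvec = 0"
  using omega_lincomb[OF zero_tvec_in_tangent_space zero_tvec_in_tangent_space, of p 0 0]
  by (simp add: zero_tvec_def)

lemma g0_zero: "Z \<in> tangent_space A p \<Longrightarrow> g0 p zero_tvec Z = 0"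
  using g0_lincomb[OF zero_tvec_in_tangent_space zero_tvec_in_tangent_space, of Z p 0 0]
  by (simp add: zero_tvec_def)

lemma fermat_zero: "F p zero_tvec = 0"
  by (simp add: fermat_metric_def omega_zero g0_zero zero_tvec_in_tangent_space)

lemma omega_coord:
  assumes "(U, \<phi>) \<in> A" "p \<in> U"
  shows "\<omega> p (coord_tvec A U \<phi> p e) = (\<Sum>i\<in>Basis. (e \<bullet> i) * \<omega> p (coord_tvec A U \<phi> p i))"
proof (rule linear_eq_sum_Basis[OF linear_if_lincomb])
  fix a b e e'
  show "\<omega> p (coord_tvec A U \<phi> p (a *\<^sub>R e + b *\<^sub>R e')) =
      a * \<omega> p (coord_tvec A U \<phi> p e) + b * \<omega> p (coord_tvec A U \<phi> p e')"
    using assms by (simp add: coord_tvec_lincomb omega_lincomb coord_tvec_in_tangent_space[OF atlas])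
qed

lemma g0_coord:
  assumes "(U, \<phi>) \<in> A" "p \<in> U"
  shows "g0 p (coord_tvec A U \<phi> p e) (coord_tvec A U \<phi> p e) =
    (\<Sum>i\<in>Basis. (e \<bullet> i) * (\<Sum>j\<in>Basis. (e \<bullet> j) *
      g0 p (coord_tvec A U \<phi> p i) (coord_tvec A U \<phi> p j)))"
proof -
  let ?C = "coord_tvec A U \<phi> p"
  have C: "?C e \<in> tangent_space A p" for e
    using assms by (rule coord_tvec_in_tangent_space[OF atlas])
  have lin: "linear (\<lambda>e. g0 p (?C e) (?C e'))" for e'
    using assms
    by (intro linear_if_lincomb) (simp add: coord_tvec_lincomb g0_lincomb C)
  have "g0 p (?C e) (?C e') = (\<Sum>i\<in>Basis. (e \<bullet> i) * g0 p (?C i) (?C e'))" for e e'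
    by (rule linear_eq_sum_Basis[OF lin])
  note 1 = this
  have "g0 p (?C i) (?C e) = (\<Sum>j\<in>Basis. (e \<bullet> j) * g0 p (?C i) (?C j))" for i
    using 1[of e i] by (simp add: g0_sym[OF C C, of i])
  then show ?thesis using 1[of e e] by simp
qed

text \<open>In a chart the integrand is a continuous expression in \<open>\<beta>\<close>, the components of \<open>\<omega>\<close> and \<open>g0\<close>,
  and the derivative of the coordinate curve. It is in general not differentiable where the
  velocity vanishes, because of the square root.\<close>

lemma continuous_on_fermat_velocity:
  assumes c: "smooth_curve_on A {u..v} c" and "u < v"
  shows "continuous_on {u..v} (\<lambda>s. F (c s) (velocity A {u..v} c s))"
    (is "continuous_on _ ?I")
  unfolding continuous_on_eq_continuous_within
proof
  fix t assume t: "t \<in> {u..v}"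
  obtain U \<phi> J h where U: "(U, \<phi>) \<in> A" and J: "open J" "t \<in> J" "smooth_on J h"
    and h: "\<And>s. s \<in> J \<inter> {u..v} \<Longrightarrow> c s \<in> U \<and> \<phi> (c s) = h s"
    using smooth_curve_onE[OF c t] by metis
  let ?S = "J \<inter> {u..v}" and ?D = "\<lambda>s. frechet_derivative h (at s) 1"
  have cont: "continuous_on ?S (\<lambda>s. f (c s))" if "smooth_fun_on A U f" for f
  proof -
    have "continuous_on (\<phi> ` U) (f \<circ> inv_into U \<phi>)"
      using smooth_on_imp_continuous_on[OF smooth_fun_on_chart[OF that U]] by simp
    moreover have "continuous_on ?S h"
      using smooth_on_imp_continuous_on[OF J(3)] by (rule continuous_on_subset) auto
    moreover have "h ` ?S \<subseteq> \<phi> ` U"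
    proof (rule image_subsetI)
      fix s assume "s \<in> ?S"
      from h[OF this] show "h s \<in> \<phi> ` U" by (metis imageI)
    qed
    ultimately have "continuous_on ?S (\<lambda>s. (f \<circ> inv_into U \<phi>) (h s))"
      by (rule continuous_on_compose2)
    then show ?thesis
    proof (rule continuous_on_eq)
      fix s assume "s \<in> ?S"
      then have "c s \<in> U" "h s = \<phi> (c s)" using h by auto
      then show "(f \<circ> inv_into U \<phi>) (h s) = f (c s)"
        using atlas U by simp
    qed
  qed
  have D: "continuous_on ?S ?D"
    using smooth_on_imp_continuous_on_derivative[OF J(3)] by (rule continuous_on_subset) auto
  have "smooth_fun_on A U \<beta>"
    using beta_smooth chart_facts(5)[OF atlas] unfolding smooth_fun_on_def
    by (fastforce intro: smooth_on_subset)
  note b = cont[OF this]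
  have w: "continuous_on ?S (\<lambda>s. \<omega> (c s) (coord_tvec A U \<phi> (c s) i))" if "i \<in> Basis" for i
    using omega U that unfolding smooth_one_form_def by (intro cont) blast
  have g: "continuous_on ?S (\<lambda>s. g0 (c s) (coord_tvec A U \<phi> (c s) i) (coord_tvec A U \<phi> (c s) j))"
    if "i \<in> Basis" "j \<in> Basis" for i j
    using g0 U that unfolding smooth_symmetric_2_tensor_def by (intro cont) blast
  have "continuous_on ?S (\<lambda>s. F (c s) (coord_tvec A U \<phi> (c s) (?D s)))"
  proof -
    have "continuous_on ?S (\<lambda>s. \<Sum>i\<in>Basis. (?D s \<bullet> i) * \<omega> (c s) (coord_tvec A U \<phi> (c s) i))"
      using D w by (intro continuous_intros) auto
    then have 1: "continuous_on ?S (\<lambda>s. \<omega> (c s) (coord_tvec A U \<phi> (c s) (?D s)))"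
      by (rule continuous_on_eq) (simp add: omega_coord[OF U] h)
    have "continuous_on ?S (\<lambda>s. \<Sum>i\<in>Basis. (?D s \<bullet> i) * (\<Sum>j\<in>Basis. (?D s \<bullet> j) *
        g0 (c s) (coord_tvec A U \<phi> (c s) i) (coord_tvec A U \<phi> (c s) j)))"
      using D g by (intro continuous_intros) auto
    then have 2: "continuous_on ?S
        (\<lambda>s. g0 (c s) (coord_tvec A U \<phi> (c s) (?D s)) (coord_tvec A U \<phi> (c s) (?D s)))"
      by (rule continuous_on_eq) (simp add: g0_coord[OF U] h)
    have "\<beta> x \<noteq> 0" for x using beta_pos[of x] by simp
    then show ?thesis
      unfolding fermat_metric_def using b 1 2 by (intro continuous_intros) auto
  qed
  then have "continuous_on ?S ?I"
  proof (rule continuous_on_eq)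
    fix s assume "s \<in> ?S"
    then show "F (c s) (coord_tvec A U \<phi> (c s) (?D s)) = ?I s"
      using velocity_eq_coord_tvec[OF atlas U J(1) _ J(3) h _ \<open>u < v\<close>] by simp
  qed
  then have "continuous (at t within ?S) ?I"
    using t J by (simp add: continuous_on_eq_continuous_within)
  moreover have "at t within ?S = at t within {u..v}"
    using J by (intro at_within_nhd[of t J]) auto
  ultimately show "continuous (at t within {u..v}) ?I" by simp
qed

text \<open>With \<open>\<tau> = dt(V)\<close>, \<open>w = \<omega>(v)\<close>, \<open>q = g0(v, v)\<close>, dividing \<open>g(V, V) < 0\<close> by \<open>\<beta>\<close> and completing
  the square gives \<open>(\<tau> - w/\<beta>)\<^sup>2 > w\<^sup>2/\<beta>\<^sup>2 + q/\<beta>\<close>, while \<open>g(V, \<partial>\<^sub>t) < 0\<close> selects the branch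
  \<open>\<tau> > w/\<beta>\<close>. Together they say \<open>\<tau> > F(v)\<close>.\<close>

lemma future_timelike_iff:
  assumes v: "push_tvec A (snd p) snd V \<in> tangent_space A (snd p)"
  shows "future_timelike (som_metric A \<beta> \<omega> g0) (som_time_field A) p V \<longleftrightarrow>
    F (snd p) (push_tvec A (snd p) snd V) < V fst"
proof -
  define x b \<tau> w q where "x = snd p" and "b = \<beta> x" and "\<tau> = V fst"
    and "w = \<omega> x (push_tvec A x snd V)"
    and "q = g0 x (push_tvec A x snd V) (push_tvec A x snd V)"
  have "som_time_field A p fst = 1"
    unfolding som_time_field_def velocity_fst[OF atlas] by (simp add: o_def)
  moreover have "push_tvec A x snd (som_time_field A p) = zero_tvec"
    using push_velocity_snd[OF atlas, of "\<lambda>s. (s, snd p)" "fst p" UNIV]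
    by (simp add: x_def som_time_field_def o_def velocity_constant)
  moreover have "g0 x (push_tvec A x snd V) zero_tvec = 0"
    using g0_sym[OF v zero_tvec_in_tangent_space] g0_zero[OF v] by (simp add: x_def)
  ultimately have metric: "som_metric A \<beta> \<omega> g0 p V (som_time_field A p) = - b * \<tau> + w"
      "som_metric A \<beta> \<omega> g0 p V V = - b * \<tau>\<^sup>2 + 2 * \<tau> * w + q"
    by (simp_all add: som_metric_def Let_def omega_zero power2_eq_square algebra_simps
        flip: x_def b_def \<tau>_def w_def q_def)
  have b: "0 < b" using beta_pos by (simp add: b_def)
  have "0 \<le> q + 1 / b * w\<^sup>2"
  proof (cases "push_tvec A x snd V = zero_tvec")
    case True
    then show ?thesis by (simp add: w_def q_def omega_zero g0_zero zero_tvec_in_tangent_space)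
  next
    case False
    then show ?thesis using pos_def[of _ x] v unfolding w_def q_def b_def x_def by fastforce
  qed
  moreover define k m where "k = w / b" and "m = q / b"
  then have wq: "w = b * k" "q = b * m" using b by simp_all
  ultimately have "0 \<le> b * (m + k\<^sup>2)" using b by (simp add: algebra_simps power2_eq_square)
  then have nonneg: "0 \<le> k\<^sup>2 + m" using b by (simp add: zero_le_mult_iff)
  have "F x (push_tvec A x snd V) = k + sqrt (k\<^sup>2 + m)"
    using b by (simp add: fermat_metric_def k_def m_def power_divide flip: w_def q_def b_def)
  then have "F x (push_tvec A x snd V) < \<tau> \<longleftrightarrow> sqrt (k\<^sup>2 + m) < \<tau> - k"
    by auto
  also have "\<dots> \<longleftrightarrow> 0 < \<tau> - k \<and> k\<^sup>2 + m < (\<tau> - k)\<^sup>2"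
  proof (cases "0 < \<tau> - k")
    case True
    then have "sqrt (k\<^sup>2 + m) < sqrt ((\<tau> - k)\<^sup>2) \<longleftrightarrow> k\<^sup>2 + m < (\<tau> - k)\<^sup>2"
      by (simp only: real_sqrt_less_iff)
    with True show ?thesis by simp
  next
    case False
    moreover have "0 \<le> sqrt (k\<^sup>2 + m)" using nonneg by simp
    ultimately show ?thesis by linarith
  qed
  also have "0 < \<tau> - k \<longleftrightarrow> b * (k - \<tau>) < 0"
    using b by (simp add: mult_less_0_iff)
  also have "b * (k - \<tau>) = - b * \<tau> + w"
    by (simp add: wq algebra_simps)
  also have "k\<^sup>2 + m < (\<tau> - k)\<^sup>2 \<longleftrightarrow> m + 2 * \<tau> * k - \<tau>\<^sup>2 < 0"
    by (auto simp: power2_diff)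
  also have "\<dots> \<longleftrightarrow> b * (m + 2 * \<tau> * k - \<tau>\<^sup>2) < 0"
    using b by (simp only: mult_less_0_iff) auto
  also have "b * (m + 2 * \<tau> * k - \<tau>\<^sup>2) = - b * \<tau>\<^sup>2 + 2 * \<tau> * w + q"
    by (simp add: wq algebra_simps)
  finally show ?thesis
    by (auto simp: future_timelike_def metric x_def \<tau>_def)
qed

end

section \<open>Chronology and Fermat length\<close>

lemma antiderivative_of_real_polynomial:
  fixes p :: "real \<Rightarrow> real"
  assumes "real_polynomial_function p"
  obtains P where "real_polynomial_function P" "\<And>x. (P has_real_derivative p x) (at x)"
proof -
  obtain a n where p: "p = (\<lambda>x. \<Sum>i\<le>n. a i * x ^ i)"
    using assms unfolding real_polynomial_function_iff_sum by blast
  let ?P = "\<lambda>x. \<Sum>i\<le>n. a i / real (Suc i) * x ^ Suc i"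
  have "(?P has_real_derivative p x) (at x)" for x
    unfolding p
  proof (rule DERIV_sum)
    fix i
    show "((\<lambda>x. a i / real (Suc i) * x ^ Suc i) has_real_derivative a i * x ^ i) (at x)"
      using DERIV_cmult[OF DERIV_pow[of "Suc i" x], of "a i / real (Suc i)"]
      by (simp del: of_nat_Suc power_Suc)
  qed
  moreover have "real_polynomial_function ?P"
  proof (rule real_polynomial_function_sum)
    fix i
    have "real_polynomial_function (\<lambda>x::real. x)"
      by (rule real_polynomial_function.intros(1)[OF bounded_linear_ident])
    then show "real_polynomial_function (\<lambda>x. a i / real (Suc i) * x ^ Suc i)"
      by (intro real_polynomial_function.intros(4) real_polynomial_function_power
          real_polynomial_function.intros(2))
  qed simp
  ultimately show ?thesis using that by blast
qed

text \<open>The velocities over the whole interval and over its two parts are taken within different sets,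
  but they agree away from the end points, which form a null set.\<close>

lemma has_integral_velocity_join:
  fixes G :: "'s::topological_space \<Rightarrow> 's tvec \<Rightarrow> real"
  assumes "a < u" "u < v"
    and 1: "((\<lambda>s. G (c s) (velocity A {a..u} c s)) has_integral l) {a..u}"
    and 2: "((\<lambda>s. G (c s) (velocity A {u..v} c s)) has_integral m) {u..v}"
  shows "((\<lambda>s. G (c s) (velocity A {a..v} c s)) has_integral l + m) {a..v}"
proof -
  have "((\<lambda>s. G (c s) (velocity A {a..v} c s)) has_integral l) {a..u}"
  proof (rule has_integral_spike_finite[OF _ _ 1, of "{a, u}"])
    fix s assume "s \<in> {a..u} - {a, u}"
    then show "G (c s) (velocity A {a..v} c s) = G (c s) (velocity A {a..u} c s)"
      using velocity_interior[of s "{a..v}" "{a..u}" A c] assms by auto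
  qed simp
  moreover have "((\<lambda>s. G (c s) (velocity A {a..v} c s)) has_integral m) {u..v}"
  proof (rule has_integral_spike_finite[OF _ _ 2, of "{u, v}"])
    fix s assume "s \<in> {u..v} - {u, v}"
    then show "G (c s) (velocity A {a..v} c s) = G (c s) (velocity A {u..v} c s)"
      using velocity_interior[of s "{a..v}" "{u..v}" A c] assms by auto
  qed simp
  ultimately show ?thesis
    using assms by (intro has_integral_combine[of a u v]) auto
qed

definition timelike_segment where
  "timelike_segment A g Z c u v \<longleftrightarrow> smooth_curve_on A {u..v} c \<and>
     (\<forall>t\<in>{u..v}. future_timelike g Z (c t) (velocity A {u..v} c t))"

lemma future_timelike_curve_iff:
  "future_timelike_curve A g Z a b c \<longleftrightarrow> piecewise (timelike_segment A g Z c) a b"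
  by (simp add: future_timelike_curve_def timelike_segment_def[abs_def])

lemma glueable_timelike_segment: "glueable (timelike_segment A g Z)"
  unfolding glueable_def
proof (intro conjI allI impI)
  fix c d u v assume "u < v" and eq: "\<forall>s\<in>{u..v}. c s = d s" and c: "timelike_segment A g Z c u v"
  have "velocity A {u..v} c t = velocity A {u..v} d t" if "t \<in> {u..v}" for t
    using that eq by (intro velocity_cong) auto
  with c eq show "timelike_segment A g Z d u v"
    using smooth_curve_on_cong[of A "{u..v}" c "{u..v}" d] unfolding timelike_segment_def by auto
next
  fix c u v k assume "timelike_segment A g Z c u v"
  then show "timelike_segment A g Z (\<lambda>s. c (s - k)) (u + k) (v + k)"
    unfolding timelike_segment_def velocity_shift by (auto intro: smooth_curve_on_shift)
qed

context som_spacetime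
begin

abbreviation "Chron_Step \<equiv>
  segment_rel (timelike_segment (som_atlas A) (som_metric A \<beta> \<omega> g0) (som_time_field A))"

text \<open>The first component of such a curve is a running length, so that the end points of a chain of
  segments record the total length of the chain.\<close>
definition length_segment :: "(real \<Rightarrow> real \<times> 's) \<Rightarrow> real \<Rightarrow> real \<Rightarrow> bool" where
  "length_segment c u v \<longleftrightarrow> smooth_curve_on A {u..v} (snd \<circ> c) \<and>
     fst (c v) - fst (c u) = curve_length A F u v (snd \<circ> c)"

abbreviation "Length_Step \<equiv> segment_rel length_segment"

lemma glueable_length_segment: "glueable length_segment"
  unfolding glueable_def
proof (intro conjI allI impI)
  fix c d :: "real \<Rightarrow> real \<times> 's" and u v
  assume "u < v" and eq: "\<forall>s\<in>{u..v}. c s = d s" and c: "length_segment c u v"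
  moreover have "curve_length A F u v (snd \<circ> c) = curve_length A F u v (snd \<circ> d)"
    using eq by (intro curve_length_cong) auto
  ultimately show "length_segment d u v"
    using smooth_curve_on_cong[of A "{u..v}" "snd \<circ> c" "{u..v}" "snd \<circ> d"]
    unfolding length_segment_def by auto
next
  fix c :: "real \<Rightarrow> real \<times> 's" and u v k assume "length_segment c u v"
  then show "length_segment (\<lambda>s. c (s - k)) (u + k) (v + k)"
    using smooth_curve_on_shift[of A u v "snd \<circ> c" k] curve_length_shift[of A F u k v "snd \<circ> c"]
    unfolding length_segment_def by (simp add: o_def)
qed

lemma length_step_curve:
  assumes "u < v" "smooth_curve_on A {u..v} c"
  shows "Length_Step (t, c u) (t + curve_length A F u v c, c v)"
proof -
  let ?c = "\<lambda>s. (if s \<le> u then t else t + curve_length A F u v c, c s)"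
  have "length_segment ?c u v"
    using assms by (simp add: length_segment_def o_def)
  with assms show ?thesis
    unfolding segment_rel_def by (intro exI[of _ ?c] exI[of _ u] exI[of _ v]) auto
qed

lemma length_step_iff:
  "Length_Step (s, x) (t, y) \<longleftrightarrow> (\<exists>c u v. u < v \<and> smooth_curve_on A {u..v} c \<and>
     c u = x \<and> c v = y \<and> t - s = curve_length A F u v c)"
proof
  assume "Length_Step (s, x) (t, y)"
  then obtain c u v where "u < v" "length_segment c u v" "c u = (s, x)" "c v = (t, y)"
    unfolding segment_rel_def by blast
  then show "\<exists>c u v. u < v \<and> smooth_curve_on A {u..v} c \<and>
     c u = x \<and> c v = y \<and> t - s = curve_length A F u v c"
    unfolding length_segment_def
    by (intro exI[of _ "snd \<circ> c"] exI[of _ u] exI[of _ v]) auto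
next
  assume "\<exists>c u v. u < v \<and> smooth_curve_on A {u..v} c \<and>
     c u = x \<and> c v = y \<and> t - s = curve_length A F u v c"
  then obtain c u v where "u < v" "smooth_curve_on A {u..v} c" "c u = x" "c v = y"
    "t = s + curve_length A F u v c" by (auto simp: algebra_simps)
  then show "Length_Step (s, x) (t, y)"
    using length_step_curve[of u v c s] by simp
qed

lemma length_step_translate: "Length_Step (s, x) (t, y) \<Longrightarrow> Length_Step (s + k, x) (t + k, y)"
  unfolding length_step_iff by simp

lemma length_chain_translate:
  "tranclp Length_Step p q \<Longrightarrow> tranclp Length_Step (fst p + k, snd p) (fst q + k, snd q)"
proof (induction rule: tranclp.induct)
  case (r_into_trancl p q)
  then show ?case using length_step_translate[of "fst p" "snd p" "fst q" "snd q"] by auto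
next
  case (trancl_into_trancl p q r)
  then show ?case
    using length_step_translate[of "fst q" "snd q" "fst r" "snd r"]
    by (auto intro: tranclp.trancl_into_trancl)
qed

text \<open>Along a timelike curve, time minus the length travelled has the derivative \<open>t' - F(c') > 0\<close>
  and is therefore strictly increasing.\<close>

lemma chronological_step_imp_shorter_length_step:
  assumes "Chron_Step p q"
  shows "\<exists>l<fst q. Length_Step p (l, snd q)"
proof -
  obtain c u v where "u < v" and c: "smooth_curve_on (som_atlas A) {u..v} c"
    and timelike: "\<And>t. t \<in> {u..v} \<Longrightarrow> future_timelike (som_metric A \<beta> \<omega> g0) (som_time_field A)
      (c t) (velocity (som_atlas A) {u..v} c t)"
    and ends: "c u = p" "c v = q"
    using assms unfolding segment_rel_def timelike_segment_def by blast
  note x = smooth_curve_on_som_atlasD(1)[OF c] and T = smooth_curve_on_som_atlasD(2)[OF c]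
  let ?I = "\<lambda>s. F ((snd \<circ> c) s) (velocity A {u..v} (snd \<circ> c) s)"
  let ?T' = "\<lambda>s. vector_derivative (fst \<circ> c) (at s within {u..v})"
  have faster: "?I t < ?T' t" if "t \<in> {u..v}" for t
    using timelike[OF that] velocity_in_tangent_space[OF atlas x that \<open>u < v\<close>]
    by (subst (asm) future_timelike_iff) (simp_all add: push_velocity_snd[OF atlas] velocity_fst[OF atlas])
  let ?G = "\<lambda>s. (fst \<circ> c) s - integral {u..s} ?I"
  have DG: "(?G has_real_derivative (?T' t - ?I t)) (at t within {u..v})" if "t \<in> {u..v}" for t
  proof (rule DERIV_diff)
    show "((fst \<circ> c) has_real_derivative ?T' t) (at t within {u..v})"
      unfolding has_real_derivative_iff_has_vector_derivative
      using T[OF that] vector_derivative_works by blast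
    show "((\<lambda>s. integral {u..s} ?I) has_real_derivative ?I t) (at t within {u..v})"
      by (rule integral_has_real_derivative[OF continuous_on_fermat_velocity[OF x \<open>u < v\<close>] that])
  qed
  have "?G u < ?G v"
  proof (rule DERIV_pos_imp_increasing_open[OF \<open>u < v\<close>])
    show "continuous_on {u..v} ?G"
      by (rule DERIV_continuous_on[OF DG])
    fix t assume t: "u < t" "t < v"
    then have "at t within {u..v} = at t" by (intro at_within_interior) simp
    then show "\<exists>y. (?G has_real_derivative y) (at t) \<and> 0 < y"
      using DG[of t] faster[of t] t by (intro exI[of _ "?T' t - ?I t"]) auto
  qed
  then have "fst p + curve_length A F u v (snd \<circ> c) < fst q"
    using ends by (simp add: curve_length_def)
  moreover have "Length_Step p (fst p + curve_length A F u v (snd \<circ> c), snd q)"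
    using length_step_curve[OF \<open>u < v\<close> x, of "fst p"] ends by simp
  ultimately show ?thesis by blast
qed

text \<open>Let \<open>\<delta>\<close> be the excess of the prescribed time increment over the length, per unit of the parameter.
  A polynomial \<open>g\<close> within \<open>\<delta>/2\<close> of \<open>F(c')\<close> has an integral that exceeds the length by at most half of
  the excess. Adding the constant \<open>\<kappa>\<close> that adjusts the time increment to the prescribed value then
  raises \<open>g\<close> by at least \<open>\<delta>/2\<close>, hence above \<open>F(c')\<close>.\<close>

lemma length_step_imp_later_chronological_step:
  assumes "Length_Step p q" "fst q < t"
  shows "Chron_Step p (t, snd q)"
proof -
  have "Length_Step (fst p, snd p) (fst q, snd q)" using assms(1) by simp
  then obtain c u v where "u < v" and c: "smooth_curve_on A {u..v} c"
    and ends: "c u = snd p" "c v = snd q" and len: "fst q - fst p = curve_length A F u v c"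
    unfolding length_step_iff by blast
  let ?I = "\<lambda>s. F (c s) (velocity A {u..v} c s)"
  note cont = continuous_on_fermat_velocity[OF c \<open>u < v\<close>]
  define \<delta> where "\<delta> = (t - fst q) / (v - u)"
  have "0 < \<delta>" using assms(2) \<open>u < v\<close> by (simp add: \<delta>_def)
  then obtain g where g: "real_polynomial_function g" "\<And>s. s \<in> {u..v} \<Longrightarrow> \<bar>?I s - g s\<bar> < \<delta> / 2"
    using Stone_Weierstrass_real_polynomial_function[OF compact_Icc cont, of "\<delta> / 2"] by auto
  obtain P where P: "real_polynomial_function P" "\<And>s. (P has_real_derivative g s) (at s)"
    using antiderivative_of_real_polynomial[OF g(1)] by blast
  have "P v - P u \<le> curve_length A F u v c + \<delta> / 2 * (v - u)"
  proof -
    have g_int: "(g has_integral P v - P u) {u..v}"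
      using \<open>u < v\<close> P(2)
      by (intro fundamental_theorem_of_calculus)
        (auto simp flip: has_real_derivative_iff_has_vector_derivative intro: has_field_derivative_at_within)
    have "((\<lambda>s. ?I s + \<delta> / 2) has_integral curve_length A F u v c + \<delta> / 2 * (v - u)) {u..v}"
      using has_integral_add[OF integrable_integral[OF integrable_continuous_real[OF cont]]
          has_integral_const_real[of "\<delta> / 2" u v]] \<open>u < v\<close>
      by (simp add: curve_length_def mult.commute)
    then show ?thesis
    proof (rule has_integral_le[OF g_int])
      fix s assume "s \<in> {u..v}"
      from g(2)[OF this] show "g s \<le> ?I s + \<delta> / 2" by linarith
    qed
  qed
  define \<kappa> where "\<kappa> = (t - fst p - (P v - P u)) / (v - u)"
  have \<kappa>: "\<delta> / 2 \<le> \<kappa>"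
  proof -
    have "\<delta> / 2 * (v - u) \<le> t - fst p - (P v - P u)"
      using \<open>P v - P u \<le> _\<close> len \<open>u < v\<close> by (simp add: \<delta>_def field_simps)
    then show ?thesis using \<open>u < v\<close> by (simp add: \<kappa>_def le_divide_eq)
  qed
  define T where "T = (\<lambda>s. P s + (\<kappa> * s + (fst p - P u - \<kappa> * u)))"
  have "smooth_on UNIV T"
    unfolding T_def
    by (intro smooth_on_add smooth_on_mult smooth_on_const smooth_on_ident
        smooth_on_real_polynomial_function P(1) open_UNIV)
  from smooth_curve_on_som_atlas[OF c this]
  have curve: "smooth_curve_on (som_atlas A) {u..v} (\<lambda>s. (T s, c s))" .
  have "(T has_real_derivative g s + \<kappa>) (at s)" for s
    unfolding T_def by (auto intro!: derivative_eq_intros P(2))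
  then have "(T has_vector_derivative g s + \<kappa>) (at s within {u..v})" for s
    by (simp add: has_real_derivative_iff_has_vector_derivative has_vector_derivative_at_within)
  then have T': "vector_derivative T (at s within {u..v}) = g s + \<kappa>" if "s \<in> {u..v}" for s
    using vector_derivative_within_cbox[of u v s T "g s + \<kappa>"] that \<open>u < v\<close> by simp
  have "timelike_segment (som_atlas A) (som_metric A \<beta> \<omega> g0) (som_time_field A) (\<lambda>s. (T s, c s)) u v"
    unfolding timelike_segment_def
  proof (intro conjI ballI)
    fix s assume s: "s \<in> {u..v}"
    have push: "push_tvec A (c s) snd (velocity (som_atlas A) {u..v} (\<lambda>s. (T s, c s)) s) =
        velocity A {u..v} c s"
      using push_velocity_snd[OF atlas, of "\<lambda>s. (T s, c s)" s "{u..v}"] by (simp add: o_def)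
    have "?I s < g s + \<kappa>" using g(2)[OF s] \<kappa> by linarith
    then show "future_timelike (som_metric A \<beta> \<omega> g0) (som_time_field A) (T s, c s)
        (velocity (som_atlas A) {u..v} (\<lambda>s. (T s, c s)) s)"
      using velocity_in_tangent_space[OF atlas c s \<open>u < v\<close>] T'[OF s]
      by (subst future_timelike_iff) (simp_all add: push velocity_fst[OF atlas] o_def)
  qed (rule curve)
  moreover have "T u = fst p" by (simp add: T_def)
  moreover have "\<kappa> * (v - u) = t - fst p - (P v - P u)"
    using \<open>u < v\<close> by (simp add: \<kappa>_def)
  then have "T v = t" by (simp add: T_def algebra_simps)
  ultimately show ?thesis
    unfolding segment_rel_def using \<open>u < v\<close> ends
    by (intro exI[of _ "\<lambda>s. (T s, c s)"] exI[of _ u] exI[of _ v]) auto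
qed

text \<open>From right to left, half of the time to spare is used up on the last segment and half is left
  for the chain before it. In the other direction, translating each further length segment makes
  it start at the length accumulated so far.\<close>

lemma chronological_chain_iff_length_chain:
  "tranclp Chron_Step p q \<longleftrightarrow> (\<exists>l<fst q. tranclp Length_Step p (l, snd q))"
proof
  assume "tranclp Chron_Step p q"
  then show "\<exists>l<fst q. tranclp Length_Step p (l, snd q)"
  proof induction
    case (base q)
    then show ?case using chronological_step_imp_shorter_length_step by blast
  next
    case (step q r)
    obtain l where l: "l < fst q" "tranclp Length_Step p (l, snd q)" using step.IH by blast
    obtain m where m: "m < fst r" "Length_Step q (m, snd r)"
      using chronological_step_imp_shorter_length_step[OF step.hyps(2)] by blast
    have "Length_Step (l, snd q) (m + (l - fst q), snd r)"
      using length_step_translate[of "fst q" "snd q" m "snd r" "l - fst q"] m by simp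
    with l m show ?case
      by (intro exI[of _ "m + (l - fst q)"]) (auto intro: tranclp.trancl_into_trancl)
  qed
next
  have *: "tranclp Length_Step p q \<Longrightarrow> fst q < t \<Longrightarrow> tranclp Chron_Step p (t, snd q)" for q t
  proof (induction arbitrary: t rule: tranclp_induct)
    case (base q)
    then show ?case using length_step_imp_later_chronological_step by blast
  next
    case (step q r)
    define \<epsilon> where "\<epsilon> = (t - fst r) / 2"
    then have "0 < \<epsilon>" using step.prems by simp
    then have chain: "tranclp Chron_Step p (fst q + \<epsilon>, snd q)" by (intro step.IH) simp
    have "Length_Step (fst q + \<epsilon>, snd q) (fst r + \<epsilon>, snd r)"
      using length_step_translate[of "fst q" "snd q" "fst r" "snd r" \<epsilon>] step.hyps(2) by simp
    moreover have "fst r + \<epsilon> < t"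
      using step.prems by (simp add: \<epsilon>_def field_simps)
    ultimately have "Chron_Step (fst q + \<epsilon>, snd q) (t, snd r)"
      using length_step_imp_later_chronological_step[of "(fst q + \<epsilon>, snd q)" "(fst r + \<epsilon>, snd r)" t]
      by simp
    with chain show ?case by (rule tranclp.trancl_into_trancl)
  qed
  assume "\<exists>l<fst q. tranclp Length_Step p (l, snd q)"
  then obtain l where "l < fst q" "tranclp Length_Step p (l, snd q)" by blast
  then show "tranclp Chron_Step p q" using *[of "(l, snd q)" "fst q"] by simp
qed

lemma has_integral_curve_length:
  assumes "u < v" "smooth_curve_on A {u..v} c"
  shows "((\<lambda>s. F (c s) (velocity A {u..v} c s)) has_integral curve_length A F u v c) {u..v}"
  unfolding curve_length_def
  using assms by (intro integrable_integral integrable_continuous_real continuous_on_fermat_velocity)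

text \<open>Chains of length segments account exactly for the lengths over which the pre-distance is the
  infimum.\<close>

lemma piecewise_smooth_curve_length_iff:
  "(\<exists>a b c. piecewise_smooth_curve A a b c \<and> c a = x \<and> c b = y \<and>
      curve_length A F a b c = l) \<longleftrightarrow>
    tranclp Length_Step (0, x) (l, y)"
proof
  assume "\<exists>a b c. piecewise_smooth_curve A a b c \<and> c a = x \<and> c b = y \<and> curve_length A F a b c = l"
  then obtain a b c where pw: "tranclp (\<lambda>u v. u < v \<and> smooth_curve_on A {u..v} c) a b"
    and ends: "c a = x" "c b = y" "curve_length A F a b c = l"
    unfolding piecewise_smooth_curve_def piecewise_iff_tranclp by blast
  have "\<exists>l. ((\<lambda>s. F (c s) (velocity A {a..b} c s)) has_integral l) {a..b} \<and> a < b \<and>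
      tranclp Length_Step (0, c a) (l, c b)"
    using pw
  proof induction
    case (base v)
    then show ?case using has_integral_curve_length[of a v c] length_step_curve[of a v c 0] by auto
  next
    case (step u v)
    then obtain l where l: "((\<lambda>s. F (c s) (velocity A {a..u} c s)) has_integral l) {a..u}"
      "a < u" "tranclp Length_Step (0, c a) (l, c u)" by blast
    have "((\<lambda>s. F (c s) (velocity A {u..v} c s)) has_integral curve_length A F u v c) {u..v}"
      using step.hyps by (intro has_integral_curve_length) auto
    from has_integral_velocity_join[OF l(2) _ l(1) this]
    have "((\<lambda>s. F (c s) (velocity A {a..v} c s)) has_integral l + curve_length A F u v c) {a..v}"
      using step.hyps by simp
    moreover have "tranclp Length_Step (0, c a) (l + curve_length A F u v c, c v)"
      using l(3) length_step_curve[of u v c l] step.hyps by (auto intro: tranclp.trancl_into_trancl)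
    ultimately show ?case using l(2) step.hyps by (intro exI conjI) auto
  qed
  then show "tranclp Length_Step (0, x) (l, y)"
    using ends by (auto simp: curve_length_def integral_unique)
next
  assume "tranclp Length_Step (0, x) (l, y)"
  then obtain a b c where pw: "tranclp (\<lambda>u v. u < v \<and> length_segment c u v) a b"
    and ends: "c a = (0, x)" "c b = (l, y)"
    using piecewise_curve_iff_tranclp[OF glueable_length_segment]
    unfolding piecewise_iff_tranclp by metis
  let ?c = "snd \<circ> c"
  have "((\<lambda>s. F (?c s) (velocity A {a..b} ?c s)) has_integral fst (c b) - fst (c a)) {a..b} \<and> a < b"
    using pw
  proof induction
    case (base v)
    then show ?case
      using has_integral_curve_length[of a v ?c] by (simp add: length_segment_def o_def)
  next
    case (step u v)
    then have "((\<lambda>s. F (?c s) (velocity A {u..v} ?c s)) has_integral fst (c v) - fst (c u)) {u..v}"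
      using has_integral_curve_length[of u v ?c] unfolding length_segment_def by simp
    with step show ?case
      using has_integral_velocity_join[of a u v F ?c A "fst (c u) - fst (c a)" "fst (c v) - fst (c u)"]
      by (auto simp: o_def)
  qed
  then have "curve_length A F a b ?c = l"
    using ends by (auto simp: curve_length_def integral_unique)
  moreover have "piecewise_smooth_curve A a b ?c"
    unfolding piecewise_smooth_curve_def piecewise_iff_tranclp
    using tranclp_less_mono[OF pw, of "\<lambda>u v. smooth_curve_on A {u..v} ?c"]
    by (auto simp: length_segment_def)
  ultimately show "\<exists>a b c. piecewise_smooth_curve A a b c \<and> c a = x \<and> c b = y \<and> curve_length A F a b c = l"
    using ends by (intro exI[of _ a] exI[of _ b] exI[of _ ?c]) auto
qed

section \<open>The pre-distance\<close>

abbreviation "d \<equiv> pre_dist A F"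

lemma pre_dist_less_iff: "d x y < ereal r \<longleftrightarrow> (\<exists>l<r. tranclp Length_Step (0, x) (l, y))"
proof -
  have "{ereal (curve_length A F a b c) | a b c.
      piecewise_smooth_curve A a b c \<and> c a = x \<and> c b = y} = {ereal l | l. tranclp Length_Step (0, x) (l, y)}"
    unfolding piecewise_smooth_curve_length_iff[symmetric] by blast
  then show ?thesis
    unfolding pre_dist_def by (auto simp: Inf_less_iff)
qed

text \<open>As the infimum is taken over the lengths of curves, \<open>d x y < r\<close> says that some curve is shorter
  than \<open>r\<close>. This strict inequality is the one that chronology produces.\<close>

lemma chronological_chain_iff_pre_dist:
  "tranclp Chron_Step p q \<longleftrightarrow> d (snd p) (snd q) < ereal (fst q - fst p)"
proof -
  have "tranclp Length_Step p (l, y) \<longleftrightarrow> tranclp Length_Step (0, snd p) (l - fst p, y)" for l y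
    using length_chain_translate[of p "(l, y)" "- fst p"]
      length_chain_translate[of "(0, snd p)" "(l - fst p, y)" "fst p"] by auto
  then have "tranclp Chron_Step p q \<longleftrightarrow> (\<exists>l<fst q. tranclp Length_Step (0, snd p) (l - fst p, snd q))"
    unfolding chronological_chain_iff_length_chain by simp
  also have "\<dots> \<longleftrightarrow> (\<exists>l<fst q - fst p. tranclp Length_Step (0, snd p) (l, snd q))"
  proof safe
    fix l assume "l < fst q - fst p" "tranclp Length_Step (0, snd p) (l, snd q)"
    then show "\<exists>l<fst q. tranclp Length_Step (0, snd p) (l - fst p, snd q)"
      by (intro exI[of _ "l + fst p"]) auto
  next
    fix l assume "l < fst q" "tranclp Length_Step (0, snd p) (l - fst p, snd q)"
    then show "\<exists>l<fst q - fst p. tranclp Length_Step (0, snd p) (l, snd q)"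
      by (intro exI[of _ "l - fst p"]) auto
  qed
  finally show ?thesis unfolding pre_dist_less_iff .
qed

lemma chron_future_eq:
  "chron_future (som_atlas A) (som_metric A \<beta> \<omega> g0) (som_time_field A) p =
    {q. d (snd p) (snd q) < ereal (fst q - fst p)}"
  and chron_past_eq:
  "chron_past (som_atlas A) (som_metric A \<beta> \<omega> g0) (som_time_field A) p =
    {q. d (snd q) (snd p) < ereal (fst p - fst q)}"
  unfolding chron_future_def chron_past_def future_timelike_curve_iff
    chronological_chain_iff_pre_dist[symmetric]
    piecewise_curve_iff_tranclp[OF glueable_timelike_segment] by simp_all

lemma pre_dist_triangle:
  assumes "d x y < ereal r" "d y z < ereal r'"
  shows "d x z < ereal (r + r')"
proof -
  obtain l m where l: "l < r" "tranclp Length_Step (0, x) (l, y)" and m: "m < r'" "tranclp Length_Step (0, y) (m, z)"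
    using assms unfolding pre_dist_less_iff by blast
  then have "tranclp Length_Step (l, y) (m + l, z)"
    using length_chain_translate[of "(0, y)" "(m, z)" l] by simp
  with l m show ?thesis
    unfolding pre_dist_less_iff by (intro exI[of _ "m + l"]) (auto intro: tranclp_trans)
qed

lemma pre_dist_self: "d x x \<le> 0"
proof -
  obtain U \<phi> where U: "(U, \<phi>) \<in> A" "x \<in> U" using chart_at[OF atlas] .
  have "smooth_curve_on A {0..1} (\<lambda>_. x)"
    unfolding smooth_curve_on_def
    using U by (auto intro!: bexI[of _ "(U, \<phi>)"] exI[of _ UNIV] exI[of _ "\<lambda>_. \<phi> x"] smooth_on_const)
  from length_step_curve[OF _ this, of 0]
  have "Length_Step (0, x) (curve_length A F 0 1 (\<lambda>_. x), x)" by simp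
  moreover have "curve_length A F 0 1 (\<lambda>_. x) = 0"
  proof -
    have "velocity A {0..1} (\<lambda>_. x) s = zero_tvec" if "s \<in> {0..1}" for s
      using that by (intro velocity_constant) (simp add: trivial_limit_within islimpt_Icc)
    then have "curve_length A F 0 1 (\<lambda>_. x) = integral {0..1} (\<lambda>s::real. 0)"
      unfolding curve_length_def by (intro integral_cong) (simp add: fermat_zero)
    then show ?thesis by simp
  qed
  ultimately have *: "d x x < ereal r" if "0 < r" for r
    unfolding pre_dist_less_iff using that by (intro exI[of _ 0]) auto
  show ?thesis
  proof (rule ccontr)
    assume "\<not> d x x \<le> 0"
    then have "\<exists>r>0. ereal r < d x x"
      using ereal_dense2[of 0 "d x x"] by auto
    then obtain r where "0 < r" "ereal r < d x x" by blast
    with *[of r] show False by simp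
  qed
qed

text \<open>Coordinate balls are convex, so coordinate line segments join their points in both directions.\<close>

lemma chart_neighbourhood_connected:
  obtains N where "open N" "p \<in> N"
    "\<And>x y. x \<in> N \<Longrightarrow> y \<in> N \<Longrightarrow> \<exists>l. Length_Step (0, x) (l, y)"
proof -
  obtain U \<phi> where U: "(U, \<phi>) \<in> A" "p \<in> U" using chart_at[OF atlas] .
  note chart = chart_facts[OF atlas U(1)]
  obtain e where e: "0 < e" "ball (\<phi> p) e \<subseteq> \<phi> ` U"
  proof -
    have "open (\<phi> ` U)" "\<phi> p \<in> \<phi> ` U" using chart(5)[OF open_UNIV] U(2) by simp_all
    then show ?thesis using that openE by metis
  qed
  define N where "N = U \<inter> \<phi> -` ball (\<phi> p) e"
  have "open N"
    unfolding N_def using continuous_open_preimage[OF chart(3,1), of "ball (\<phi> p) e"] by simp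
  moreover have "p \<in> N" using U e by (simp add: N_def)
  moreover have "\<exists>l. Length_Step (0, x) (l, y)" if xy: "x \<in> N" "y \<in> N" for x y
  proof -
    define h where "h = (\<lambda>s::real. \<phi> x + s *\<^sub>R (\<phi> y - \<phi> x))"
    define c where "c = inv_into U \<phi> \<circ> h"
    have h: "h s \<in> \<phi> ` U" if "s \<in> {0..1}" for s
    proof -
      have "h s = (1 - s) *\<^sub>R \<phi> x + s *\<^sub>R \<phi> y" by (simp add: h_def algebra_simps)
      then have "h s \<in> ball (\<phi> p) e"
        using convexD[OF convex_ball, of "\<phi> x" "\<phi> p" e "\<phi> y" "1 - s" s] xy that by (simp add: N_def)
      with e show ?thesis by blast
    qed
    have "smooth_on UNIV (\<lambda>s::real. s *\<^sub>R (\<phi> y - \<phi> x))"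
      by (rule smooth_on_linear_compose[OF open_UNIV bounded_linear_scaleR_left smooth_on_ident])
    then have "smooth_on UNIV h"
      unfolding h_def by (intro smooth_on_add smooth_on_const) auto
    moreover have "c s \<in> U \<and> \<phi> (c s) = h s" if "s \<in> {0..1}" for s
      using h[OF that] by (auto simp: c_def inv_into_into f_inv_into_f)
    ultimately have "smooth_curve_on A {0..1} c"
      unfolding smooth_curve_on_def
      using U(1) by (intro ballI bexI[of _ "(U, \<phi>)"] case_prodI exI[of _ UNIV] exI[of _ h]) auto
    moreover have "c 0 = x" "c 1 = y"
      using xy atlas U(1) by (simp_all add: c_def h_def N_def)
    ultimately show ?thesis using length_step_curve[of 0 1 c 0] by auto
  qed
  ultimately show ?thesis using that by blast
qed

text \<open>Mutual reachability is an equivalence relation with open classes on a connected space. It is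
  made symmetric by definition, which avoids reversing curves.\<close>

lemma pre_dist_finite: "\<exists>r. d x y < ereal r"
proof -
  define R where "R x y \<longleftrightarrow> (\<exists>r. d x y < ereal r) \<and> (\<exists>r. d y x < ereal r)" for x y
  have "R x y"
  proof (rule connected_equivalence_relation[OF connected])
    show "R y x" if "R x y" for x y using that by (auto simp: R_def)
    show "R x z" if "R x y" "R y z" for x y z
      using that pre_dist_triangle unfolding R_def by blast
    show "\<exists>T. openin (top_of_set UNIV) T \<and> p \<in> T \<and> (\<forall>x\<in>T. R p x)" for p
    proof -
      obtain N where N: "open N" "p \<in> N" "\<And>x y. x \<in> N \<Longrightarrow> y \<in> N \<Longrightarrow> \<exists>l. Length_Step (0, x) (l, y)"
        using chart_neighbourhood_connected[of p] by blast
      have "\<exists>r. d x y < ereal r" if "x \<in> N" "y \<in> N" for x y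
        using N(3)[OF that] unfolding pre_dist_less_iff by (meson lt_ex gt_ex tranclp.r_into_trancl)
      with N(1,2) show ?thesis by (intro exI[of _ N]) (auto simp: R_def)
    qed
  qed auto
  then show ?thesis by (simp add: R_def)
qed

text \<open>Charts have open image in a Euclidean space of positive dimension. If the symmetrized
  pre-distance is positive off the diagonal, a second point \<open>z\<close> provides the finite value \<open>d z x\<close>
  that tells apart the pasts of different points over \<open>x\<close>.\<close>

lemma exists_other_point: "\<exists>y::'s. y \<noteq> x"
proof (rule ccontr)
  assume single: "\<not> ?thesis"
  obtain U \<phi> where U: "(U, \<phi>) \<in> A" "x \<in> U" using chart_at[OF atlas] .
  have "U \<inter> UNIV = {x}" using single U by auto
  with chart_facts(5)[OF atlas U(1) open_UNIV] have "open {\<phi> x}" by simp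
  then show False using not_open_singleton by blast
qed

end

section \<open>Distinguishing points by their past or future\<close>

lemma ereal_finite_cases:
  fixes e :: ereal
  assumes "\<exists>r. e < ereal r"
  obtains "e = - \<infinity>" | a where "e = ereal a"
  using assms by (cases e) auto

text \<open>The set of all \<open>(r, z)\<close> with \<open>d z x < s - r\<close> is the past of \<open>(s, x)\<close>. The values of \<open>d\<close> may be
  \<open>-\<infinity>\<close>; the triangle inequality is stated with real upper bounds so that no undetermined
  sums of infinities occur.\<close>

lemma shifted_balls_separate_iff_pos:
  fixes d :: "'s \<Rightarrow> 's \<Rightarrow> ereal"
  assumes triangle: "\<And>x y z r r'. d x y < ereal r \<Longrightarrow> d y z < ereal r' \<Longrightarrow> d x z < ereal (r + r')"
    and finite: "\<And>x y. \<exists>r. d x y < ereal r"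
    and self: "\<And>x. d x x \<le> 0"
    and other: "\<And>x :: 's. \<exists>y. y \<noteq> x"
  shows "(\<forall>s x t y. (\<forall>r z. d z x < ereal (s - r) \<longleftrightarrow> d z y < ereal (t - r)) \<longrightarrow> s = t \<and> x = y) \<longleftrightarrow>
    (\<forall>x y. x \<noteq> y \<longrightarrow> 0 < (d x y + d y x) / 2)"
proof
  assume pos: "\<forall>x y. x \<noteq> y \<longrightarrow> 0 < (d x y + d y x) / 2"
  have real: "\<exists>a b. d x y = ereal a \<and> d y x = ereal b \<and> 0 < a + b" if "x \<noteq> y" for x y
    using pos[rule_format, OF that] finite[of x y] finite[of y x]
    by (cases "d x y"; cases "d y x") auto
  show "\<forall>s x t y. (\<forall>r z. d z x < ereal (s - r) \<longleftrightarrow> d z y < ereal (t - r)) \<longrightarrow> s = t \<and> x = y"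
  proof (intro allI impI)
    fix s x t y assume eq: "\<forall>r z. d z x < ereal (s - r) \<longleftrightarrow> d z y < ereal (t - r)"
    have "x = y"
    proof (rule ccontr)
      assume "x \<noteq> y"
      then obtain a b where ab: "d x y = ereal a" "d y x = ereal b" "0 < a + b"
        using real[of x y] by blast
      have pos: "d w w < ereal e" if "0 < e" for w e
        using self[of w] by (rule le_less_trans) (simp add: that)
      \<comment> \<open>the point \<open>(s - e, x)\<close> lies in the past of \<open>(s, x)\<close>, hence in that of \<open>(t, y)\<close>\<close>
      have "a \<le> t - s + e" if "0 < e" for e
        using eq[rule_format, of x "s - e"] pos[OF that, of x] ab(1) by simp
      then have "a \<le> t - s"
        by (rule field_le_epsilon)
      have "b \<le> s - t + e" if "0 < e" for e
        using eq[rule_format, of y "t - e"] pos[OF that, of y] ab(2) by simp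
      then have "b \<le> s - t"
        by (rule field_le_epsilon)
      with \<open>a \<le> t - s\<close> ab(3) show False by simp
    qed
    moreover have "s = t"
    proof -
      obtain z where "z \<noteq> x" using other[of x] by blast
      then obtain a where "d z x = ereal a" using real[of z x] by blast
      then have "a < s - r \<longleftrightarrow> a < t - r" for r
        using eq[rule_format, of z r] \<open>x = y\<close> by simp
      from this[of "s - a"] this[of "t - a"] show ?thesis by simp
    qed
    ultimately show "s = t \<and> x = y" by simp
  qed
next
  assume dist: "\<forall>s x t y. (\<forall>r z. d z x < ereal (s - r) \<longleftrightarrow> d z y < ereal (t - r)) \<longrightarrow> s = t \<and> x = y"
  have no_minf: "d x y \<noteq> - \<infinity>" for x y
  proof
    assume minf: "d x y = - \<infinity>"
    \<comment> \<open>a detour through \<open>x\<close> and \<open>y\<close> joins any two points by arbitrarily negative lengths\<close>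
    have all: "d z w < ereal r" for z w r
    proof -
      obtain a b where "d z x < ereal a" "d y w < ereal b" using finite[of z x] finite[of y w] by blast
      moreover have "d x y < ereal (r - a - b)" using minf by simp
      ultimately have "d z w < ereal (a + (r - a - b) + b)" using triangle by blast
      then show ?thesis by simp
    qed
    from dist[rule_format, of x 0 x 1] all show False by simp
  qed
  show "\<forall>x y. x \<noteq> y \<longrightarrow> 0 < (d x y + d y x) / 2"
  proof (intro allI impI, rule ccontr)
    fix x y assume "x \<noteq> y" and nonpos: "\<not> 0 < (d x y + d y x) / 2"
    obtain a b where ab: "d x y = ereal a" "d y x = ereal b"
      using no_minf[of x y] no_minf[of y x] finite[of x y] finite[of y x]
      by (metis ereal_finite_cases)
    with nonpos have "a + b \<le> 0" by simp
    \<comment> \<open>by the triangle inequality \<open>(0, x)\<close> and \<open>(a, y)\<close> have the same past\<close>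
    have "d z x < ereal (0 - r) \<longleftrightarrow> d z y < ereal (a - r)" for z r
    proof
      assume "d z x < ereal (0 - r)"
      then obtain r' where r': "d z x < ereal r'" "r' < 0 - r"
        using ereal_dense2[of "d z x" "ereal (0 - r)"] by auto
      have "d x y < ereal (a - r - r')" using r' ab by simp
      from triangle[OF r'(1) this] show "d z y < ereal (a - r)" by simp
    next
      assume "d z y < ereal (a - r)"
      then obtain r' where r': "d z y < ereal r'" "r' < a - r"
        using ereal_dense2[of "d z y" "ereal (a - r)"] by auto
      have "d y x < ereal (0 - r - r')" using r' ab \<open>a + b \<le> 0\<close> by simp
      from triangle[OF r'(1) this] show "d z x < ereal (0 - r)" by simp
    qed
    then have "x = y" using dist by blast
    with \<open>x \<noteq> y\<close> show False by simp
  qed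
qed

context som_spacetime
begin

lemma past_distinguishing_iff:
  "past_distinguishing (som_atlas A) (som_metric A \<beta> \<omega> g0) (som_time_field A) \<longleftrightarrow>
    (\<forall>x y. x \<noteq> y \<longrightarrow> 0 < sym_pre_dist A F x y)"
proof -
  have "past_distinguishing (som_atlas A) (som_metric A \<beta> \<omega> g0) (som_time_field A) \<longleftrightarrow>
    (\<forall>s x t y. (\<forall>r z. d z x < ereal (s - r) \<longleftrightarrow> d z y < ereal (t - r)) \<longrightarrow> s = t \<and> x = y)"
    unfolding past_distinguishing_def chron_past_eq by (simp add: set_eq_iff)
  also have "\<dots> \<longleftrightarrow> (\<forall>x y. x \<noteq> y \<longrightarrow> 0 < (d x y + d y x) / 2)"
    by (rule shifted_balls_separate_iff_pos)
      (auto intro: pre_dist_triangle pre_dist_finite pre_dist_self exists_other_point)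
  finally show ?thesis unfolding sym_pre_dist_def .
qed

text \<open>Reversing time turns futures into pasts and the pre-distance into its reverse, which has the same
  symmetrization.\<close>

lemma future_distinguishing_iff:
  "future_distinguishing (som_atlas A) (som_metric A \<beta> \<omega> g0) (som_time_field A) \<longleftrightarrow>
    (\<forall>x y. x \<noteq> y \<longrightarrow> 0 < sym_pre_dist A F x y)"
proof -
  have "future_distinguishing (som_atlas A) (som_metric A \<beta> \<omega> g0) (som_time_field A) \<longleftrightarrow>
    (\<forall>s x t y. (\<forall>r z. d x z < ereal (r - s) \<longleftrightarrow> d y z < ereal (r - t)) \<longrightarrow> s = t \<and> x = y)"
    unfolding future_distinguishing_def chron_future_eq by (simp add: set_eq_iff)
  also have "\<dots> \<longleftrightarrow>
    (\<forall>s x t y. (\<forall>r z. d x z < ereal (s - r) \<longleftrightarrow> d y z < ereal (t - r)) \<longrightarrow> s = t \<and> x = y)"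
    (is "(\<forall>s x t y. ?P s x t y) \<longleftrightarrow> (\<forall>s x t y. ?Q s x t y)")
  proof -
    have reflect: "(\<forall>s x t y. P s x t y) \<longleftrightarrow> (\<forall>s x t y. Q s x t y)"
      if "\<And>s x t y. P s x t y \<longleftrightarrow> Q (- s) x (- t) y" for P Q :: "real \<Rightarrow> 's \<Rightarrow> real \<Rightarrow> 's \<Rightarrow> bool"
      using that by (metis minus_minus)
    have "(\<forall>r z. d x z < ereal (r - s) \<longleftrightarrow> d y z < ereal (r - t)) \<longleftrightarrow>
        (\<forall>r z. d x z < ereal (- s - r) \<longleftrightarrow> d y z < ereal (- t - r))" for s x t y
    proof (rule iffI; intro allI)
      fix r z assume "\<forall>r z. d x z < ereal (r - s) \<longleftrightarrow> d y z < ereal (r - t)"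
      from this[rule_format, of z "- r"]
      show "d x z < ereal (- s - r) \<longleftrightarrow> d y z < ereal (- t - r)"
        by (simp only: minus_diff_commute)
    next
      fix r z assume "\<forall>r z. d x z < ereal (- s - r) \<longleftrightarrow> d y z < ereal (- t - r)"
      from this[rule_format, of z "- r"]
      show "d x z < ereal (r - s) \<longleftrightarrow> d y z < ereal (r - t)"
        by simp
    qed
    then show ?thesis by (intro reflect) simp
  qed
  also have "\<dots> \<longleftrightarrow> (\<forall>x y. x \<noteq> y \<longrightarrow> 0 < (d y x + d x y) / 2)"
  proof (rule shifted_balls_separate_iff_pos[of "\<lambda>x y. d y x"])
    fix x y z r r' assume "d y x < ereal r" "d z y < ereal r'"
    then show "d z x < ereal (r + r')"
      using pre_dist_triangle[of z y r' x r] by (simp add: add.commute)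
  qed (auto intro: pre_dist_finite pre_dist_self exists_other_point)
  finally show ?thesis unfolding sym_pre_dist_def by (simp add: add.commute)
qed

end

theorem proposition3p11:
  fixes A :: "('s::{t2_space, second_countable_topology}, 'e::euclidean_space) atlas"
    and \<beta> :: "'s \<Rightarrow> real"
    and \<omega> :: "'s \<Rightarrow> 's tvec \<Rightarrow> real"
    and g0 :: "'s \<Rightarrow> 's tvec \<Rightarrow> 's tvec \<Rightarrow> real"
  assumes "som_spacetime A \<beta> \<omega> g0"
  shows "(past_distinguishing (som_atlas A) (som_metric A \<beta> \<omega> g0) (som_time_field A) \<longleftrightarrow>
           (\<forall>x0 x1. x0 \<noteq> x1 \<longrightarrow> 0 < sym_pre_dist A (fermat_metric \<beta> \<omega> g0) x0 x1)) \<and>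
         (future_distinguishing (som_atlas A) (som_metric A \<beta> \<omega> g0) (som_time_field A) \<longleftrightarrow>
           (\<forall>x0 x1. x0 \<noteq> x1 \<longrightarrow> 0 < sym_pre_dist A (fermat_metric \<beta> \<omega> g0) x0 x1))"
  using som_spacetime.past_distinguishing_iff[OF assms]
    som_spacetime.future_distinguishing_iff[OF assms] by blast

end
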